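(* Consider the aggregative game with $N$ players, action sets $U_i\subseteq\mathbb{R}^n$, strategy space $\mathrm{U}=\prod_{i=1}^N U_i$ and cost functions $f_i(x_i,\bm{x}_{-i})=\bar f_i(x_i,\sigma(\bm{x}))$, $\sigma(\bm{x})=\frac1N\sum_{i=1}^N\phi_i(x_i)$, with pseudo-gradient $F$ and extended pseudo-gradient $\mathbf{F}$, together with the switching graph $\mathcal{G}_{\rho(t)}$ with Laplacian $\mathcal{L}_{\rho(t)}$ (all as defined in the context). Assume: (A1) for every $i$: $U_i$ is nonempty, closed and convex; $f_i(x_i,\bm{x}_{-i})$ is convex and continuously differentiable in $x_i$ for every fixed $\bm{x}_{-i}\in U_{-i}=\prod_{j\ne i}U_j$; and there is $\mu>0$ with $(\bm{x}-\bm{x}')^{\rm T}(F(\bm{x})-F(\bm{x}'))\ge\mu\|\bm{x}-\bm{x}'\|^2$ for all $\bm{x},\bm{x}'\in\mathrm{U}$; (A2) there is $\theta>0$ with $\|F(\bm{x})-F(\bm{x}')\|\le\theta\|\bm{x}-\bm{x}'\|$ for all $\bm{x},\bm{x}'\in\mathrm{U}$; (A3) there is $\hat\theta>0$ with $\|\mathbf{F}(\bm{x},\bm{s})-\mathbf{F}(\bm{x},\bm{s}')\|\le\hat\theta\|\bm{s}-\bm{s}'\|$ for all $\bm{x},\bm{s},\bm{s}'\in\mathbb{R}^{Nn}$, and there is $l>0$ such that the Jacobian of $\phi(\bm{x})=\mathrm{col}(\phi_1(x_1),\dots,\phi_N(x_N))$ satisfies $\left\|\frac{\partial\phi(\bm{x})}{\partial\bm{x}}\right\|\le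 l$ for all $\bm{x}$; (A4) there is $T>0$ such that the union graph $\mathcal{G}_{\rho([t,t+T))}$ is connected for all $t\ge0$, and $\mathcal{G}_{\rho(t)}$ is weight-balanced for every $t\ge0$. Let $\mathrm{x}^*\in\mathrm{U}$ be the (unique) Nash equilibrium. Let $\alpha>0$ and $\beta>0$ be arbitrary, let $H(t)$ be the matrix function described in the context (which depends on $\alpha,\beta$), and let $p>0$ be a constant with $\|H(t)\|\le p$ for all $t\ge0$. Define $$M=2pl\sqrt{\alpha^2+1},\quad k_1(\delta_1)=\frac{\delta_1(2\mu-\delta_1\theta^2)}{2+\delta_1\theta},\quad k_2(\delta_1)=\frac{(\delta_1\theta+2)M+\delta_1\hat\theta}{2},\quad k_3(\delta_1)=\delta_1M\hat\theta,$$ $$\delta_1^*=\frac{2\mu}{\theta^2},\qquad \delta_2^*(\delta_1)=\frac{k_1(\delta_1)}{k_1(\delta_1)k_3(\delta_1)+k_2^2(\delta_1)}.$$ Then for any $0<\delta_1<\delta_1^*$, any $0<\delta_2<\delta_2^*(\delta_1)$, and any initial conditions $x_i(0)\in U_i$, $s_i(0)\in\mathbb{R}^n$, $v_i(0)\in\mathbb{R}^n$ ($i=1,\dots,N$) with $\sum_{i=1}^Nv_i(0)=\bm{0}$, the solution $\mathrm{col}(\bm{x}(t),\bm{s}(t),\bm{v}(t))$ of $$\begin{aligned}\dot{\bm{x}}&=\delta_2\big(\mathbf{P}_{\mathrm{U}}(\bm{x}-\delta_1\mathbf{F}(\bm{x},\bm{s}))-\bm{x}\big),\\ \dot{\bm{s}}&=-\alpha(\bm{s}-\phi(\bm{x}))-\beta(\mathcal{L}_{\rho(t)}\otimes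 I_n)\bm{s}-\bm{v},\\ \dot{\bm{v}}&=\alpha\beta(\mathcal{L}_{\rho(t)}\otimes I_n)\bm{s}\end{aligned}$$ converges exponentially, as $t\to+\infty$, to $\mathrm{col}\big(\mathrm{x}^*,\ \mathrm{P}_n\phi(\mathrm{x}^* ),\ \alpha\mathrm{P}_n^\perp\phi(\mathrm{x}^* )\big)$, where $\mathrm{P}_n=\frac{\bm{1}_N\bm{1}_N^{\rm T}}{N}\otimes I_n$ and $\mathrm{P}_n^\perp=I_{Nn}-\mathrm{P}_n$.
   Context: Notation: $\|\cdot\|$ is the Euclidean norm and induced matrix norm; $\mathrm{col}(a_1,\dots,a_k)$ stacks column vectors; $\otimes$ is the Kronecker product; $\bm{1}_N$ is the all-ones vector. For a closed convex set $\Omega$, $\mathbf{P}_\Omega(x)=\arg\min_{x'\in\Omega}\|x'-x\|^2$ is the Euclidean projection. Write $\bm{x}=\mathrm{col}(x_1,\dots,x_N)$, $\bm{s}=\mathrm{col}(s_1,\dots,s_N)$, $\bm{v}=\mathrm{col}(v_1,\dots,v_N)$ in $\mathbb{R}^{Nn}$ with $x_i,s_i,v_i\in\mathbb{R}^n$, and $\bm{x}_{-i}$ for $\bm{x}$ with $x_i$ removed. Game: players $\mathcal{V}=\{1,\dots,N\}$, action sets $U_i\subseteq\mathbb{R}^n$, cost functions $f_i(x_i,\bm{x}_{-i})=\bar f_i(x_i,\sigma(\bm{x}))$ with $\sigma(\bm{x})=\frac1N\sum_i\phi_i(x_i)$, $\phi_i:\mathbb{R}^n\to\mathbb{R}^n$;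 $\bar f_i$ and $\phi_i$ are continuously differentiable. A Nash equilibrium is $\mathrm{x}^*=(\mathrm{x}_i^*,\mathbf{x}_{-i}^* )\in\mathrm{U}$ with $f_i(\mathrm{x}_i^*,\mathbf{x}_{-i}^* )\le f_i(\mathrm{x}_i,\mathbf{x}_{-i}^* )$ for all $i$ and all $\mathrm{x}_i\in U_i$; under (A1) it exists and is unique. The pseudo-gradient is $F(\bm{x})=\mathrm{col}(\nabla_1f_1(\bm{x}),\dots,\nabla_Nf_N(\bm{x}))$, where $\nabla_if_i=(\partial f_i/\partial x_i)^{\rm T}$. The extended pseudo-gradient is $\mathbf{F}(\bm{x},\bm{s})=\mathrm{col}(J_1(x_1,s_1),\dots,J_N(x_N,s_N))$ with $$J_i(x_i,s_i)=\nabla_y\bar f_i(y,s_i)|_{y=x_i}+\tfrac1N\nabla\phi_i(x_i)\nabla_y\bar f_i(x_i,y)|_{y=s_i},$$ where gradients of scalar functions are column vectors and $\nabla\phi_i$ is the transposed Jacobian of $\phi_i$; thus $\mathbf{F}(\bm{x},\bm{1}_N\otimes\sigma(\bm{x}))=F(\bm{x})$. Switching graph: $\rho:[0,\infty)\to\mathcal{P}=\{1,\dots,n_0\}$ is piecewise constant: there are switching instants $t_0=0<t_1<t_2<\cdots$ with $t_{j+1}-t_j\ge\tau$ for some $\tau>0$, and $\rho$ is constant on each $[t_j,t_{j+1})$. Given graphs $\mathcal{G}_k=(\mathcal{V},\mathcal{E}_k)$, $k\in\mathcal{P}$, the switching graph is $\mathcal{G}_{\rho(t)}=(\mathcal{V},\mathcal{E}_{\rho(t)})$,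 with weighted adjacency matrix $\mathcal{A}_{\rho(t)}=[a_{ij}(t)]$ (depending on $t$ only through $\rho(t)$), where $a_{ij}(t)>0$ if $(j,i)\in\mathcal{E}_{\rho(t)}$, $a_{ij}(t)=0$ otherwise, and $a_{ii}(t)=0$. The Laplacian is $\mathcal{L}_{\rho(t)}=\mathrm{diag}\big(\sum_ja_{1j}(t),\dots,\sum_ja_{Nj}(t)\big)-\mathcal{A}_{\rho(t)}$. The union graph is $\mathcal{G}_{\rho([t,t+s))}=\bigcup_{t_i\in[t,t+s)}\mathcal{G}_{\rho(t_i)}$ (union of edge sets). A directed graph is connected if some node has directed paths to every other node. $\mathcal{G}_{\rho(t)}$ is weight-balanced at time $t$ if $\sum_ja_{ij}(t)=\sum_ja_{ji}(t)$ for all $i$. The matrix $H(t)$: let $Q=[r,R]\in\mathbb{R}^{N\times N}$ be an orthogonal matrix with $r=\bm{1}_N/\sqrt N$ and $R\in\mathbb{R}^{N\times(N-1)}$, put $\mathbf{R}=R\otimes I_n$, $\mathbf{L}_{\rho(t)}=\mathcal{L}_{\rho(t)}\otimes I_n$, and $$A(t)=\begin{bmatrix}-\alpha I_n&\bm{0}&\bm{0}\\ \bm{0}&-\alpha I_{Nn-n}-\beta\mathbf{R}^{\rm T}\mathbf{L}_{\rho(t)}\mathbf{R}&-I_{Nn-n}\\ \bm{0}&\alpha\beta\mathbf{R}^{\rm T}\mathbf{L}_{\rho(t)}\mathbf{R}&\bm{0}\end{bmatrix}.$$ It is a known result (taken as given) that under (A4), for all $\alpha,\beta>0$, the origin of $\dot{\check\zeta}=A(t)\check\zeta$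 is exponentially stable, and consequently there exists a bounded, symmetric, continuous matrix function $H(t)\in\mathbb{R}^{(2Nn-n)\times(2Nn-n)}$, $t\ge0$, and constants $h_1,h_2>0$ with $h_1\|v\|^2\le v^{\rm T}H(t)v\le h_2\|v\|^2$ for all $v$ and $t\ge 0$, and on each interval $[t_j,t_{j+1})$, $-\dot H(t)=A^{\rm T}(t)H(t)+H(t)A(t)+I_{2Nn-n}$. This is the $H(t)$ of the claim. Solutions of the closed-loop system are understood as continuous functions of $t\ge0$ satisfying the equations on each interval $[t_j,t_{j+1})$ (right derivative at $t_j$); it is a standing understanding that for every initial condition the solution of the closed-loop system exists on $[0,\infty)$ and is unique. "$y(t)$ converges exponentially to $y^*$" means there are $C,\lambda>0$ with $\|y(t)-y^*\|\le Ce^{-\lambda t}$ for all $t\ge0$. *)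

theory Defs
  imports "HOL-Analysis.Analysis"
begin

text \<open>
  Players are the elements of a finite type 'p (so N = CARD('p)), actions live in real^'n, and
  R^(Nn) is real^('p \<times> 'n); its norm is the Euclidean norm of the stacked vector.
\<close>

definition col :: "('p \<Rightarrow> real^'n) \<Rightarrow> real^('p::finite \<times> 'n::finite)" where
  "col z = (\<chi> a. z (fst a) $ snd a)"

definition blk :: "real^('p::finite \<times> 'n::finite) \<Rightarrow> 'p \<Rightarrow> real^'n" where
  "blk x i = (\<chi> k. x $ (i, k))"

text \<open>The strategy profile (y, x_{-i}).\<close>

definition upd :: "real^('p::finite \<times> 'n::finite) \<Rightarrow> 'p \<Rightarrow> real^'n \<Rightarrow> real^('p \<times> 'n)" where
  "upd x i y = col ((blk x)(i := y))"

definition kron :: "real^'b^'a \<Rightarrow> real^'d^'c \<Rightarrow>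
    real^('b::finite \<times> 'd::finite)^('a::finite \<times> 'c::finite)" where
  "kron A B = (\<chi> u w. A $ fst u $ fst w * B $ snd u $ snd w)"

text \<open>Norms on the matrix types are entrywise; the induced norm is the operator norm.\<close>

definition matnorm :: "real^'b::finite^'a::finite \<Rightarrow> real" where
  "matnorm A = onorm ((*v) A)"

definition cont_diff :: "('a::real_normed_vector \<Rightarrow> 'b::real_normed_vector) \<Rightarrow> bool" where
  "cont_diff f \<longleftrightarrow>
     (\<exists>f'. (\<forall>x. (f has_derivative blinfun_apply (f' x)) (at x)) \<and> continuous_on UNIV f')"

definition grad :: "(real^'n::finite \<Rightarrow> real) \<Rightarrow> real^'n \<Rightarrow> real^'n" where
  "grad f x = (THE D. GDERIV f x :> D)"

definition profiles :: "('p::finite \<Rightarrow> (real^'n::finite) set) \<Rightarrow> (real^('p \<times> 'n)) set" where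
  "profiles U = {x. \<forall>i. blk x i \<in> U i}"

definition aggregate ::
    "('p::finite \<Rightarrow> real^'n::finite \<Rightarrow> real^'n) \<Rightarrow> real^('p \<times> 'n) \<Rightarrow> real^'n" where
  "aggregate \<phi> x = (1 / real CARD('p)) *\<^sub>R (\<Sum>i\<in>UNIV. \<phi> i (blk x i))"

definition stack_map ::
    "('p::finite \<Rightarrow> real^'n::finite \<Rightarrow> real^'n) \<Rightarrow> real^('p \<times> 'n) \<Rightarrow> real^('p \<times> 'n)" where
  "stack_map \<phi> x = col (\<lambda>i. \<phi> i (blk x i))"

definition cost ::
    "('p::finite \<Rightarrow> real^'n::finite \<Rightarrow> real^'n \<Rightarrow> real) \<Rightarrow> ('p \<Rightarrow> real^'n \<Rightarrow> real^'n) \<Rightarrow>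
     'p \<Rightarrow> real^('p \<times> 'n) \<Rightarrow> real" where
  "cost fb \<phi> i x = fb i (blk x i) (aggregate \<phi> x)"

definition nash_equilibrium ::
    "('p::finite \<Rightarrow> (real^'n::finite) set) \<Rightarrow> ('p \<Rightarrow> real^'n \<Rightarrow> real^'n \<Rightarrow> real) \<Rightarrow>
     ('p \<Rightarrow> real^'n \<Rightarrow> real^'n) \<Rightarrow> real^('p \<times> 'n) \<Rightarrow> bool" where
  "nash_equilibrium U fb \<phi> x \<longleftrightarrow>
     x \<in> profiles U \<and> (\<forall>i. \<forall>y\<in>U i. cost fb \<phi> i x \<le> cost fb \<phi> i (upd x i y))"

definition pseudo_grad ::
    "('p::finite \<Rightarrow> real^'n::finite \<Rightarrow> real^'n \<Rightarrow> real) \<Rightarrow> ('p \<Rightarrow> real^'n \<Rightarrow> real^'n) \<Rightarrow>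
     real^('p \<times> 'n) \<Rightarrow> real^('p \<times> 'n)" where
  "pseudo_grad fb \<phi> x = col (\<lambda>i. grad (\<lambda>y. cost fb \<phi> i (upd x i y)) (blk x i))"

definition ext_pseudo_grad ::
    "('p::finite \<Rightarrow> real^'n::finite \<Rightarrow> real^'n \<Rightarrow> real) \<Rightarrow> ('p \<Rightarrow> real^'n \<Rightarrow> real^'n) \<Rightarrow>
     real^('p \<times> 'n) \<Rightarrow> real^('p \<times> 'n) \<Rightarrow> real^('p \<times> 'n)" where
  "ext_pseudo_grad fb \<phi> x s = col (\<lambda>i.
     grad (\<lambda>y. fb i y (blk s i)) (blk x i) +
     (1 / real CARD('p)) *\<^sub>R
       (transpose (jacobian (\<phi> i) (at (blk x i))) *v grad (\<lambda>y. fb i (blk x i) y) (blk s i)))"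

definition switching_signal :: "nat \<Rightarrow> (nat \<Rightarrow> real) \<Rightarrow> (real \<Rightarrow> nat) \<Rightarrow> bool" where
  "switching_signal n0 ts \<rho> \<longleftrightarrow>
     ts 0 = 0 \<and> (\<exists>\<tau>>0. \<forall>j. ts (Suc j) - ts j \<ge> \<tau>) \<and>
     (\<forall>t\<ge>0. \<rho> t \<in> {1..n0}) \<and>
     (\<forall>j. \<forall>t\<in>{ts j..<ts (Suc j)}. \<rho> t = \<rho> (ts j))"

text \<open>An edge (j, i) gives player i access to the data of player j, i.e. a positive entry (i, j).\<close>

definition weighted_adjacency :: "('p \<times> 'p) set \<Rightarrow> real^'p^'p::finite \<Rightarrow> bool" where
  "weighted_adjacency E A \<longleftrightarrow>
     (\<forall>i j. if (j, i) \<in> E then A $ i $ j > 0 else A $ i $ j = 0) \<and> (\<forall>i. A $ i $ i = 0)"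

definition laplacian :: "real^'p^'p::finite \<Rightarrow> real^'p^'p" where
  "laplacian A = (\<chi> i j. if i = j then \<Sum>k\<in>UNIV. A $ i $ k else 0) - A"

definition weight_balanced :: "real^'p^'p::finite \<Rightarrow> bool" where
  "weight_balanced A \<longleftrightarrow> (\<forall>i. (\<Sum>j\<in>UNIV. A $ i $ j) = (\<Sum>j\<in>UNIV. A $ j $ i))"

definition union_edges ::
    "(nat \<Rightarrow> ('p \<times> 'p) set) \<Rightarrow> (real \<Rightarrow> nat) \<Rightarrow> (nat \<Rightarrow> real) \<Rightarrow> real \<Rightarrow> real \<Rightarrow> ('p \<times> 'p) set" where
  "union_edges E \<rho> ts t s = (\<Union>j\<in>{j. ts j \<in> {t..<t + s}}. E (\<rho> (ts j)))"

definition digraph_connected :: "('p \<times> 'p) set \<Rightarrow> bool" where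
  "digraph_connected E \<longleftrightarrow> (\<exists>r. \<forall>i. (r, i) \<in> E\<^sup>*)"

text \<open>
  In Q = [r, R] the column r has index base and the columns of R have the N - 1 remaining
  indices.  The coordinates of R^(2Nn - n) are split as n + (N - 1)n + (N - 1)n.  The whole index
  set (rather than the index set of the columns of R) is made a type because it is nonempty also
  for N = 1.
\<close>

definition base :: 'p where
  "base = (SOME k. True)"

typedef ('p, 'n) err_index =
  "{z :: 'n + ('p \<times> 'n) + ('p \<times> 'n).
     case z of Inl _ \<Rightarrow> True | Inr (Inl u) \<Rightarrow> fst u \<noteq> base | Inr (Inr u) \<Rightarrow> fst u \<noteq> base}"
  by (rule exI [of _ "Inl undefined"]) simp

instance err_index :: (finite, finite) finite
proof
  have "(UNIV :: ('a, 'b) err_index set) = range Abs_err_index"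
    by (metis Rep_err_index_inverse surj_def)
  then show "finite (UNIV :: ('a, 'b) err_index set)"
    by (metis finite finite_imageI)
qed

lemma card_err_index:
  "CARD(('p::finite, 'n::finite) err_index) = 2 * CARD('p) * CARD('n) - CARD('n)"
proof -
  let ?B = "(UNIV - {base :: 'p}) \<times> (UNIV :: 'n set)"
  have eq: "{z :: 'n + ('p \<times> 'n) + ('p \<times> 'n).
      case z of Inl _ \<Rightarrow> True | Inr (Inl u) \<Rightarrow> fst u \<noteq> base | Inr (Inr u) \<Rightarrow> fst u \<noteq> base}
      = UNIV <+> (?B <+> ?B)"
    (is "?L = ?R")
  proof (rule set_eqI)
    fix z show "z \<in> ?L \<longleftrightarrow> z \<in> ?R"
    proof (cases z)
      case (Inr y)
      then show ?thesis by (cases y) (auto simp: mem_Times_iff)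
    qed auto
  qed
  have b: "card ?B = (CARD('p) - 1) * CARD('n)"
    by (simp add: card_cartesian_product card_Diff_singleton)
  have "CARD(('p, 'n) err_index) = card (UNIV <+> (?B <+> ?B) :: ('n + ('p \<times> 'n) + ('p \<times> 'n)) set)"
    unfolding eq [symmetric] by (rule type_definition.card [OF type_definition_err_index])
  also have "\<dots> = CARD('n) + ((CARD('p) - 1) * CARD('n) + (CARD('p) - 1) * CARD('n))"
    by (simp add: card_Plus b del: card_cartesian_product)
  also have "\<dots> = 2 * CARD('p) * CARD('n) - CARD('n)"
    by (cases "CARD('p)") (simp_all add: algebra_simps)
  finally show ?thesis .
qed

text \<open>
  The matrix A(t) with L the Laplacian at time t.  The entries of K with both player indices different from
  base, the only ones used, are those of (R^T \<otimes> I)(L \<otimes> I)(R \<otimes> I).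
\<close>

definition err_matrix ::
    "real \<Rightarrow> real \<Rightarrow> real^'p^'p \<Rightarrow> real^'p^'p \<Rightarrow>
     real^('p::finite, 'n::finite) err_index^('p, 'n) err_index" where
  "err_matrix \<alpha> \<beta> Q L =
     (let QQ = kron Q (mat 1 :: real^'n^'n);
          K = transpose QQ ** kron L (mat 1 :: real^'n^'n) ** QQ
      in \<chi> a b. case (Rep_err_index a, Rep_err_index b) of
           (Inl k, Inl m) \<Rightarrow> (- \<alpha> *\<^sub>R mat 1) $ k $ m
         | (Inr (Inl u), Inr (Inl w)) \<Rightarrow> (- \<alpha> *\<^sub>R mat 1 - \<beta> *\<^sub>R K) $ u $ w
         | (Inr (Inl u), Inr (Inr w)) \<Rightarrow> (- mat 1) $ u $ w
         | (Inr (Inr u), Inr (Inl w)) \<Rightarrow> ((\<alpha> * \<beta>) *\<^sub>R K) $ u $ w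
         | _ \<Rightarrow> 0)"

text \<open>
  The derivative within the half-open interval is the right derivative at its left endpoint and
  the ordinary derivative elsewhere.
\<close>

definition lyapunov_matrix ::
    "real \<Rightarrow> real \<Rightarrow> real^'p^'p \<Rightarrow> (real \<Rightarrow> real^'p^'p) \<Rightarrow> (nat \<Rightarrow> real) \<Rightarrow>
     (real \<Rightarrow> real^('p::finite, 'n::finite) err_index^('p, 'n) err_index) \<Rightarrow> bool" where
  "lyapunov_matrix \<alpha> \<beta> Q Lap ts H \<longleftrightarrow>
     bounded (H ` {0..}) \<and> continuous_on {0..} H \<and> (\<forall>t\<ge>0. transpose (H t) = H t) \<and>
     (\<exists>h1>0. \<exists>h2>0. \<forall>t\<ge>0. \<forall>v.
        h1 * (norm v)\<^sup>2 \<le> v \<bullet> (H t *v v) \<and> v \<bullet> (H t *v v) \<le> h2 * (norm v)\<^sup>2) \<and>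
     (\<forall>j. \<forall>t\<in>{ts j..<ts (Suc j)}.
        (H has_vector_derivative
           - (transpose (err_matrix \<alpha> \<beta> Q (Lap t)) ** H t +
              H t ** err_matrix \<alpha> \<beta> Q (Lap t) + mat 1))
          (at t within {ts j..<ts (Suc j)}))"

definition closed_loop_solution ::
    "('p::finite \<Rightarrow> (real^'n::finite) set) \<Rightarrow> ('p \<Rightarrow> real^'n \<Rightarrow> real^'n \<Rightarrow> real) \<Rightarrow>
     ('p \<Rightarrow> real^'n \<Rightarrow> real^'n) \<Rightarrow> real \<Rightarrow> real \<Rightarrow> real \<Rightarrow> real \<Rightarrow>
     (real \<Rightarrow> real^'p^'p) \<Rightarrow> (nat \<Rightarrow> real) \<Rightarrow>
     (real \<Rightarrow> real^('p \<times> 'n)) \<Rightarrow> (real \<Rightarrow> real^('p \<times> 'n)) \<Rightarrow> (real \<Rightarrow> real^('p \<times> 'n)) \<Rightarrow> bool" where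
  "closed_loop_solution U fb \<phi> \<alpha> \<beta> \<delta>1 \<delta>2 Lap ts x s v \<longleftrightarrow>
     continuous_on {0..} x \<and> continuous_on {0..} s \<and> continuous_on {0..} v \<and>
     (\<forall>j. \<forall>t\<in>{ts j..<ts (Suc j)}.
        (x has_vector_derivative
           \<delta>2 *\<^sub>R (closest_point (profiles U) (x t - \<delta>1 *\<^sub>R ext_pseudo_grad fb \<phi> (x t) (s t)) - x t))
          (at t within {ts j..<ts (Suc j)}) \<and>
        (s has_vector_derivative
           - \<alpha> *\<^sub>R (s t - stack_map \<phi> (x t)) -
             \<beta> *\<^sub>R (kron (Lap t) (mat 1 :: real^'n^'n) *v s t) - v t)
          (at t within {ts j..<ts (Suc j)}) \<and>
        (v has_vector_derivative
           (\<alpha> * \<beta>) *\<^sub>R (kron (Lap t) (mat 1 :: real^'n^'n) *v s t))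
          (at t within {ts j..<ts (Suc j)}))"

definition converges_exponentially :: "(real \<Rightarrow> 'a::real_normed_vector) \<Rightarrow> 'a \<Rightarrow> bool" where
  "converges_exponentially y l \<longleftrightarrow>
     (\<exists>C>0. \<exists>r>0. \<forall>t\<ge>0. norm (y t - l) \<le> C * exp (- r * t))"

definition avg_proj :: "real^('p::finite \<times> 'n::finite)^('p \<times> 'n)" where
  "avg_proj = kron (\<chi> i j. 1 / real CARD('p)) (mat 1)"

definition M_const :: "real \<Rightarrow> real \<Rightarrow> real \<Rightarrow> real" where
  "M_const p l \<alpha> = 2 * p * l * sqrt (\<alpha>\<^sup>2 + 1)"

definition k1 :: "real \<Rightarrow> real \<Rightarrow> real \<Rightarrow> real" where
  "k1 \<mu> \<theta> \<delta>1 = \<delta>1 * (2 * \<mu> - \<delta>1 * \<theta>\<^sup>2) / (2 + \<delta>1 * \<theta>)"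

definition k2 :: "real \<Rightarrow> real \<Rightarrow> real \<Rightarrow> real \<Rightarrow> real" where
  "k2 \<theta> \<theta>h M \<delta>1 = ((\<delta>1 * \<theta> + 2) * M + \<delta>1 * \<theta>h) / 2"

definition k3 :: "real \<Rightarrow> real \<Rightarrow> real \<Rightarrow> real" where
  "k3 \<theta>h M \<delta>1 = \<delta>1 * M * \<theta>h"

definition delta1_bound :: "real \<Rightarrow> real \<Rightarrow> real" where
  "delta1_bound \<mu> \<theta> = 2 * \<mu> / \<theta>\<^sup>2"

definition delta2_bound :: "real \<Rightarrow> real \<Rightarrow> real \<Rightarrow> real \<Rightarrow> real \<Rightarrow> real" where
  "delta2_bound \<mu> \<theta> \<theta>h M \<delta>1 =
     k1 \<mu> \<theta> \<delta>1 / (k1 \<mu> \<theta> \<delta>1 * k3 \<theta>h M \<delta>1 + (k2 \<theta> \<theta>h M \<delta>1)\<^sup>2)"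

end

(* Write z for the error state of the averaging estimator in the coordinates given by Q.  Weight
   balance keeps the sum of the v_i at zero and removes the base block of the Laplacian, so z obeys
   z' = A(t) z + g with |g| <= sqrt(alpha^2 + 1) l |x'|.  For V = |x - x*|^2 / 2 + z^T H(t) z, the
   contraction of the projected gradient step at the true aggregate together with
   |s - 1 (x) sigma(x)| <= |z| gives, with a = |x - x*| and b = |z|,
     V' <= - delta2 k1 a^2 + 2 delta2 k2 a b - (1 - delta2 k3) b^2,
   which is negative definite exactly when delta2 < delta2*. *)
theory Submission
  imports Defs
begin

section \<open>Switched differential inequalities\<close>

text \<open>The estimator chases a moving target: \<open>s\<close> should follow the average of
  \<open>stack_map \<phi> x\<close>, and \<open>v\<close> should follow \<alpha> times the deviation
  from that average. Subtracting \<alpha> times the tracked signal from \<open>v\<close> absorbs the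
  drive of \<open>s\<close> on the disagreement subspace, so that the derivative of the signal is
  the only input left. The average of \<open>v\<close> is a conserved mode that would never decay;
  discarding it explains the dimension 2Nn - n. The switched matrices A(t) are handled by the
  time-varying form H(t): the Lyapunov equation yields the same dissipation -|z|^2 under every A(t),
  and continuity of H makes V continuous, so that the decay on the single intervals can be chained
  through the switching instants. The step size \<delta>2 separates the time scales: the input is
  bounded through |x'|, which carries the factor \<delta>2, whereas the dissipation |z|^2 does not.
  Decay of z is not yet the claim, since z measures \<open>s\<close> and \<open>v\<close> against
  the signal at x(t); the Lipschitz bound l allows x(t) to be replaced by x*.\<close>

lemma switching_signal_unbounded:
  assumes "switching_signal n0 ts \<rho>"
  shows "\<exists>j. t < ts j"
proof -
  obtain \<tau> where \<tau>: "\<tau> > 0" "\<And>j. ts (Suc j) - ts j \<ge> \<tau>" and "ts 0 = 0"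
    using assms by (auto simp: switching_signal_def)
  have "ts j \<ge> real j * \<tau>" for j
  proof (induction j)
    case (Suc j)
    then show ?case using \<tau>(2)[of j] by (simp add: algebra_simps)
  qed (simp add: \<open>ts 0 = 0\<close>)
  moreover obtain j :: nat where "t < real j * \<tau>"
    using ex_less_of_nat_mult \<tau>(1) by blast
  ultimately show ?thesis
    by (meson less_le_trans)
qed

text \<open>The dwell time rules out accumulation of switching instants, so the half-open intervals
  cover the half-line. The interval sought precedes the least instant beyond \<open>t\<close>, whose
  index is not 0 because \<open>ts 0 = 0\<close>.\<close>

lemma switching_signal_interval:
  assumes "switching_signal n0 ts \<rho>" "t \<ge> 0"
  shows "\<exists>j. t \<in> {ts j..<ts (Suc j)}"
proof -
  let ?J = "\<lambda>j. t < ts j"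
  have ex: "\<exists>j. ?J j" using switching_signal_unbounded[OF assms(1)] .
  define j where "j = (LEAST j. ?J j)"
  have j: "t < ts j" unfolding j_def using ex by (rule LeastI_ex)
  have "j \<noteq> 0"
    using j assms by (metis switching_signal_def not_le)
  then obtain i where i: "j = Suc i" by (cases j) auto
  have "\<not> t < ts i"
    using not_less_Least[of i ?J] i by (simp add: j_def)
  then have "t \<in> {ts i..<ts (Suc i)}" using j i by auto
  then show ?thesis ..
qed

text \<open>Multiplication by \<open>exp (c * t)\<close> turns the inequality into monotonicity on
  each interval, and continuity links neighbouring intervals. The sign of \<open>c\<close> is free;
  \<open>c = 0\<close> is used for conserved quantities.\<close>

lemma piecewise_gronwall:
  fixes g :: "real \<Rightarrow> real"
  assumes sw: "switching_signal n0 ts \<rho>"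
    and cont: "continuous_on {0..} g"
    and deriv: "\<And>j t. t \<in> {ts j..<ts (Suc j)} \<Longrightarrow>
      \<exists>D. (g has_vector_derivative D) (at t within {ts j..<ts (Suc j)}) \<and> D \<le> - c * g t"
    and t: "t \<ge> 0"
  shows "g t \<le> g 0 * exp (- c * t)"
proof -
  have ts0: "ts 0 = 0" and inc: "ts j < ts (Suc j)" for j
    using sw by (auto simp: switching_signal_def) (smt (verit))
  have pos: "ts j \<ge> 0" for j
    by (induction j) (use ts0 inc in \<open>auto intro: order_trans less_imp_le\<close>)
  define h where "h \<tau> = g \<tau> * exp (c * \<tau>)" for \<tau>
  have ch: "continuous_on {0..} h"
    unfolding h_def by (intro continuous_intros cont)
  have step: "h t \<le> h (ts j)" if t: "ts j \<le> t" "t \<le> ts (Suc j)" for j t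
  proof (rule DERIV_nonpos_imp_decreasing_open[where f = h])
    fix u assume u: "ts j < u" "u < t"
    then have uI: "u \<in> {ts j..<ts (Suc j)}" using t by auto
    obtain D where D: "(g has_vector_derivative D) (at u within {ts j..<ts (Suc j)})" "D \<le> - c * g u"
      using deriv[OF uI] by blast
    \<comment> \<open>In the open interior the derivative within the half-open interval is an
      ordinary one; the two endpoints are covered by continuity.\<close>
    have "(g has_vector_derivative D) (at u within {ts j<..<ts (Suc j)})"
      using D(1) by (rule has_vector_derivative_within_subset) auto
    then have "(g has_real_derivative D) (at u)"
      using u t at_within_open[of u "{ts j<..<ts (Suc j)}"]
      by (simp add: has_real_derivative_iff_has_vector_derivative[symmetric])
    then have "(h has_real_derivative (D + c * g u) * exp (c * u)) (at u)"
      unfolding h_def by (auto intro!: derivative_eq_intros simp: algebra_simps)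
    moreover have "(D + c * g u) * exp (c * u) \<le> 0"
      using D(2) by (intro mult_nonpos_nonneg) auto
    ultimately show "\<exists>y. (h has_real_derivative y) (at u) \<and> y \<le> 0" by blast
  qed (use t ch pos[of j] in \<open>auto intro: continuous_on_subset\<close>)
  have nodes: "h (ts j) \<le> h 0" for j
  proof (induction j)
    case (Suc j)
    then show ?case using step[of j "ts (Suc j)"] inc[of j] by auto
  qed (simp add: ts0)
  obtain j where "t \<in> {ts j..<ts (Suc j)}"
    using switching_signal_interval[OF sw t] by blast
  then have "h t \<le> h 0"
    using step[of j t] nodes[of j] by auto
  then have "g t * exp (c * t) \<le> g 0" by (simp add: h_def)
  then have "g t * exp (c * t) * exp (- c * t) \<le> g 0 * exp (- c * t)"
    by (intro mult_right_mono) auto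
  then show ?thesis by (simp add: mult.assoc flip: exp_add)
qed

text \<open>Scalar monotonicity applies to every functional \<open>g t \<bullet> b\<close>; the
  choice \<open>b = g t - g 0\<close> bounds the squared distance by 0.\<close>

lemma piecewise_constant:
  fixes g :: "real \<Rightarrow> 'a::euclidean_space"
  assumes sw: "switching_signal n0 ts \<rho>"
    and cont: "continuous_on {0..} g"
    and deriv: "\<And>j t. t \<in> {ts j..<ts (Suc j)} \<Longrightarrow>
      (g has_vector_derivative 0) (at t within {ts j..<ts (Suc j)})"
    and t: "t \<ge> 0"
  shows "g t = g 0"
proof -
  have le: "g t \<bullet> b \<le> g 0 \<bullet> b" for b
  proof -
    have "g t \<bullet> b \<le> g 0 \<bullet> b * exp (- 0 * t)"
    proof (rule piecewise_gronwall[OF sw _ _ t])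
      fix j t assume "t \<in> {ts j..<ts (Suc j)}"
      from bounded_linear.has_vector_derivative[OF bounded_linear_inner_left deriv[OF this], of b]
      show "\<exists>D. ((\<lambda>t. g t \<bullet> b) has_vector_derivative D) (at t within {ts j..<ts (Suc j)}) \<and>
          D \<le> - 0 * (g t \<bullet> b)"
        by force
    qed (intro continuous_intros cont)
    then show ?thesis by simp
  qed
  from le[of "g t - g 0"] have "(g t - g 0) \<bullet> (g t - g 0) \<le> 0"
    by (simp add: inner_diff_left)
  then show ?thesis by (simp flip: power2_norm_eq_inner)
qed

text \<open>The velocity points from \<open>x t\<close> to a point of \<open>S\<close>. If
  \<open>x t\<close> were outside, its signed distance past a separating hyperplane would obey a
  decay inequality along the whole trajectory while starting negative, so it could never become
  positive.\<close>

lemma projected_flow_invariant: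
  fixes x :: "real \<Rightarrow> 'a::euclidean_space"
  assumes sw: "switching_signal n0 ts \<rho>"
    and cont: "continuous_on {0..} x"
    and deriv: "\<And>j t. t \<in> {ts j..<ts (Suc j)} \<Longrightarrow>
      (x has_vector_derivative d *\<^sub>R (y t - x t)) (at t within {ts j..<ts (Suc j)})"
    and S: "convex S" "closed S" "x 0 \<in> S" "\<And>t. y t \<in> S" and d: "d > 0"
    and t: "t \<ge> 0"
  shows "x t \<in> S"
proof (rule ccontr)
  assume "x t \<notin> S"
  then obtain a b where ab: "a \<bullet> x t < b" "\<And>z. z \<in> S \<Longrightarrow> a \<bullet> z > b"
    using separating_hyperplane_closed_point[OF S(1,2)] by blast
  have "b - a \<bullet> x t \<le> (b - a \<bullet> x 0) * exp (- d * t)"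
  proof (rule piecewise_gronwall[OF sw _ _ t])
    fix j t assume "t \<in> {ts j..<ts (Suc j)}"
    from bounded_linear.has_vector_derivative[OF bounded_linear_inner_right deriv[OF this], of a]
    have "((\<lambda>t. b - a \<bullet> x t) has_vector_derivative (- (a \<bullet> (d *\<^sub>R (y t - x t)))))
      (at t within {ts j..<ts (Suc j)})"
      by (auto intro!: derivative_eq_intros)
    moreover have "- (a \<bullet> (d *\<^sub>R (y t - x t))) \<le> - d * (b - a \<bullet> x t)"
      using ab(2)[OF S(4), of t] d by (simp add: inner_diff_right)
    ultimately show "\<exists>D. ((\<lambda>t. b - a \<bullet> x t) has_vector_derivative D) (at t within {ts j..<ts (Suc j)}) \<and>
        D \<le> - d * (b - a \<bullet> x t)"
      by blast
  qed (intro continuous_intros cont)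
  moreover have "(b - a \<bullet> x 0) * exp (- d * t) \<le> 0"
    using ab(2)[OF S(3)] by (intro mult_nonpos_nonneg) auto
  ultimately show False using ab(1) by simp
qed

text \<open>The constant is determinant over trace of the symmetric matrix with diagonal
  \<open>P\<close>, \<open>R\<close> and off-diagonal entry \<open>- S\<close>. It lies below the
  smallest eigenvalue, because the largest one is at most the trace.\<close>

lemma quadratic_form_pos_def:
  fixes P R S :: real
  assumes "P > 0" "R > 0" "S\<^sup>2 < P * R"
  obtains e where "e > 0" "\<And>a b. e * (a\<^sup>2 + b\<^sup>2) \<le> P * a\<^sup>2 - 2 * S * a * b + R * b\<^sup>2"
proof
  define e where "e = (P * R - S\<^sup>2) / (P + R)"
  show "e > 0" using assms by (simp add: e_def)
  have eq: "e * (P + R) = P * R - S\<^sup>2" using assms by (simp add: e_def)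
  have "P - e = (P\<^sup>2 + S\<^sup>2) / (P + R)"
    using assms by (simp add: e_def field_simps power2_eq_square)
  then have Pe: "P - e > 0"
    using assms by (simp add: add_pos_nonneg)
  fix a b :: real
  \<comment> \<open>Completing the square leaves the shifted determinant as coefficient of
    \<open>b\<^sup>2\<close>; the choice of \<open>e\<close> reduces it to
    \<open>e\<^sup>2\<close>.\<close>
  have "(P - e) * (P * a\<^sup>2 - 2 * S * a * b + R * b\<^sup>2 - e * (a\<^sup>2 + b\<^sup>2)) =
      ((P - e) * a - S * b)\<^sup>2 + (P * R - S\<^sup>2 - e * (P + R) + e\<^sup>2) * b\<^sup>2"
    by (simp add: power2_eq_square algebra_simps)
  also have "\<dots> \<ge> 0" by (simp add: eq)
  finally have "0 \<le> P * a\<^sup>2 - 2 * S * a * b + R * b\<^sup>2 - e * (a\<^sup>2 + b\<^sup>2)"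
    using Pe by (simp add: zero_le_mult_iff)
  then show "e * (a\<^sup>2 + b\<^sup>2) \<le> P * a\<^sup>2 - 2 * S * a * b + R * b\<^sup>2" by simp
qed

text \<open>Differentiating both copies of z contributes 2 (H z) . (A z + g), and the equation for H
  contributes -2 (H z) . (A z) - |z|^2. All terms with \<open>A\<close> cancel, so the estimate is
  uniform over the switching modes.\<close>

lemma has_vector_derivative_quadratic_form:
  fixes H :: "real \<Rightarrow> real^'m::finite^'m" and z :: "real \<Rightarrow> real^'m"
  assumes H: "(H has_vector_derivative - (transpose A ** H t + H t ** A + mat 1)) (at t within S)"
    and z: "(z has_vector_derivative A *v z t + g) (at t within S)"
    and sym: "transpose (H t) = H t"
  shows "((\<lambda>t. z t \<bullet> (H t *v z t)) has_vector_derivative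
           - (norm (z t))\<^sup>2 + 2 * (g \<bullet> (H t *v z t))) (at t within S)"
proof -
  have bil: "bounded_bilinear (\<lambda>(H :: real^'m^'m) z. H *v z)"
    unfolding bilinear_conv_bounded_bilinear[symmetric] bilinear_def
    by (auto intro!: linearI simp: matrix_vector_right_distrib matrix_vector_mult_add_rdistrib
        scaleR_matrix_vector_assoc vector_scaleR_matrix_ac matrix_vector_mult_scaleR)
  have s: "u \<bullet> (H t *v w) = (H t *v u) \<bullet> w" for u w
    by (metis dot_lmul_matrix sym vector_transpose_matrix)
  have sA: "u \<bullet> (transpose A *v w) = (A *v u) \<bullet> w" for u w
    by (metis dot_lmul_matrix transpose_matrix_vector inner_commute)
  define w where "w = H t *v z t"
  have D: "((\<lambda>t. z t \<bullet> (H t *v z t)) has_vector_derivative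
      z t \<bullet> (H t *v (A *v z t + g) + - (transpose A ** H t + H t ** A + mat 1) *v z t) +
      (A *v z t + g) \<bullet> (H t *v z t)) (at t within S)"
    by (rule bounded_bilinear.has_vector_derivative[OF bounded_bilinear_inner z
          bounded_bilinear.has_vector_derivative[OF bil H z]])
  have uminus: "(- B) *v u = - (B *v u)" for B :: "real^'m^'m" and u
    by (simp add: vec_eq_iff matrix_vector_mult_def sum_negf)
  have 1: "z t \<bullet> (H t *v (A *v z t + g)) = w \<bullet> (A *v z t) + w \<bullet> g"
    by (simp only: s w_def inner_add_right)
  have 2: "- (transpose A ** H t + H t ** A + mat 1) *v z t =
      - (transpose A *v w + H t *v (A *v z t) + z t)"
    unfolding w_def uminus matrix_vector_mult_add_rdistrib matrix_vector_mul_assoc by simp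
  have 3: "z t \<bullet> (H t *v (A *v z t)) = w \<bullet> (A *v z t)"
    by (simp only: s w_def)
  have 4: "z t \<bullet> (transpose A *v w) = w \<bullet> (A *v z t)"
    by (simp only: sA) (rule inner_commute)
  show ?thesis
  proof (rule has_vector_derivative_eq_rhs[OF D])
    show "z t \<bullet> (H t *v (A *v z t + g) + - (transpose A ** H t + H t ** A + mat 1) *v z t) +
        (A *v z t + g) \<bullet> (H t *v z t) = - (norm (z t))\<^sup>2 + 2 * (g \<bullet> (H t *v z t))"
      unfolding 2 inner_add_right inner_minus_right inner_add_left 1 3 4 w_def[symmetric]
        power2_norm_eq_inner
      using inner_commute[of w g] inner_commute[of w "A *v z t"] by linarith
  qed
qed

section \<open>Coordinates of the error system\<close>

lemma blk_col [simp]: "blk (col z) i = z i"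
  by (simp add: blk_def col_def vec_eq_iff)

lemma blk_nth [simp]: "blk x i $ k = x $ (i, k)"
  by (simp add: blk_def)

lemma col_nth [simp]: "col z $ (i, k) = z i $ k"
  by (simp add: col_def)

lemma blk_upd: "blk (upd x i y) j = (if j = i then y else blk x j)"
  by (simp add: upd_def)

lemma upd_blk_self [simp]: "upd x i (blk x i) = x"
  by (simp add: vec_eq_iff upd_def col_def)

lemma sum_prod_UNIV: "(\<Sum>u\<in>UNIV. f u) = (\<Sum>i\<in>UNIV. \<Sum>k\<in>UNIV. f (i, k))"
  for f :: "'p::finite \<times> 'n::finite \<Rightarrow> 'a::comm_monoid_add"
  by (simp add: sum.cartesian_product)

lemma inner_blk: "x \<bullet> y = (\<Sum>i\<in>UNIV. blk x i \<bullet> blk y i)"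
  by (simp add: inner_vec_def sum_prod_UNIV)

lemma linear_blk: "linear (\<lambda>x. blk x i)"
  by (auto intro!: linearI simp: vec_eq_iff)

lemma bounded_linear_blk: "bounded_linear (\<lambda>x. blk x i)"
  using linear_blk by (simp add: linear_conv_bounded_linear)

lemma kron_mult_nth:
  "(kron B (mat 1) *v z) $ (i, k) = (\<Sum>j\<in>UNIV. B $ i $ j * z $ (j, k))"
proof -
  have "(kron B (mat 1) *v z) $ (i, k) =
      (\<Sum>j\<in>UNIV. \<Sum>m\<in>UNIV. if k = m then B $ i $ j * z $ (j, m) else 0)"
    by (simp add: matrix_vector_mult_def kron_def sum_prod_UNIV mat_def if_distrib if_distribR cong: if_cong)
  then show ?thesis by simp
qed

lemma transpose_kron: "transpose (kron A B) = kron (transpose A) (transpose B)"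
  by (simp add: vec_eq_iff transpose_def kron_def)

lemma kron_mult: "kron A (mat 1) *v (kron B (mat 1) *v z) = kron (A ** B) (mat 1) *v z"
proof -
  have "(\<Sum>j\<in>UNIV. A $ i $ j * (\<Sum>m\<in>UNIV. B $ j $ m * z $ (m, k))) =
      (\<Sum>m\<in>UNIV. (\<Sum>j\<in>UNIV. A $ i $ j * B $ j $ m) * z $ (m, k))" for i k
    unfolding sum_distrib_left sum_distrib_right by (subst sum.swap) (simp add: mult.assoc)
  then show ?thesis
    by (simp add: vec_eq_iff kron_mult_nth matrix_matrix_mult_def)
qed

lemma kron_mat_1: "kron (mat 1) (mat 1) = mat 1"
  by (simp add: vec_eq_iff kron_def mat_def prod_eq_iff)

text \<open>The block with index base is the component along r, the others form the one along R.\<close>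

definition qcoord :: "real^'p^'p \<Rightarrow> real^('p::finite \<times> 'n::finite) \<Rightarrow> real^('p \<times> 'n)" where
  "qcoord Q z = transpose (kron Q (mat 1 :: real^'n^'n)) *v z"

lemma qcoord_nth: "qcoord Q z $ (i, k) = (\<Sum>j\<in>UNIV. Q $ j $ i * z $ (j, k))"
  unfolding qcoord_def transpose_kron transpose_mat kron_mult_nth by (simp add: transpose_def)

lemma linear_qcoord: "linear (qcoord Q)"
  unfolding qcoord_def by (rule matrix_vector_mul_linear)

lemma kron_orthogonal:
  fixes Q :: "real^'p::finite^'p"
  assumes "orthogonal_matrix Q"
  shows "orthogonal_matrix (kron Q (mat 1 :: real^'n::finite^'n))"
proof -
  have "transpose (kron Q (mat 1 :: real^'n^'n)) *v (kron Q (mat 1 :: real^'n^'n) *v z) = mat 1 *v z" for z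
    using assms unfolding transpose_kron transpose_mat kron_mult
    by (simp add: orthogonal_matrix kron_mat_1)
  then show ?thesis
    unfolding orthogonal_matrix matrix_vector_mul_assoc by (metis matrix_eq)
qed

lemma kron_qcoord:
  fixes Q :: "real^'p::finite^'p" and z :: "real^('p \<times> 'n::finite)"
  assumes "orthogonal_matrix Q"
  shows "kron Q (mat 1 :: real^'n^'n) *v qcoord Q z = z"
  using kron_orthogonal[OF assms, where 'n='n]
  by (simp add: qcoord_def matrix_vector_mul_assoc orthogonal_matrix_def del: transpose_matrix_vector)

lemma norm_qcoord:
  assumes "orthogonal_matrix Q"
  shows "norm (qcoord Q z) = norm z"
proof -
  have "qcoord Q z \<bullet> qcoord Q z = z \<bullet> (kron Q (mat 1) *v qcoord Q z)"
    by (simp add: qcoord_def dot_lmul_matrix)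
  then show ?thesis
    by (simp add: norm_eq_sqrt_inner kron_qcoord[OF assms])
qed

text \<open>The arguments \<open>b\<close> and \<open>c\<close> are full stacked vectors whose
  \<open>base\<close> blocks are ignored. This allows the error space to be handled with ordinary
  vectors and with the full matrix in place of its restriction.\<close>

definition err_vec :: "real^'n \<Rightarrow> real^('p \<times> 'n) \<Rightarrow> real^('p \<times> 'n) \<Rightarrow> real^('p::finite, 'n::finite) err_index" where
  "err_vec a b c = (\<chi> j. case Rep_err_index j of Inl k \<Rightarrow> a $ k
     | Inr (Inl u) \<Rightarrow> b $ u | Inr (Inr u) \<Rightarrow> c $ u)"

lemma sum_err_index:
  fixes f :: "'n::finite + ('p::finite \<times> 'n) + ('p \<times> 'n) \<Rightarrow> 'a::comm_monoid_add"
  shows "(\<Sum>j\<in>UNIV. f (Rep_err_index j)) =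
    (\<Sum>k\<in>UNIV. f (Inl k)) + ((\<Sum>u | fst u \<noteq> base. f (Inr (Inl u))) + (\<Sum>u | fst u \<noteq> base. f (Inr (Inr u))))"
proof -
  let ?B = "{u :: 'p \<times> 'n. fst u \<noteq> base}"
  have R: "range (Rep_err_index :: ('p, 'n) err_index \<Rightarrow> _) = UNIV <+> (?B <+> ?B)"
    unfolding type_definition.Rep_range[OF type_definition_err_index]
  proof (rule set_eqI)
    fix z :: "'n + ('p \<times> 'n) + ('p \<times> 'n)"
    show "z \<in> {z. case z of Inl _ \<Rightarrow> True | Inr (Inl u) \<Rightarrow> fst u \<noteq> base | Inr (Inr u) \<Rightarrow> fst u \<noteq> base} \<longleftrightarrow>
        z \<in> UNIV <+> (?B <+> ?B)"
      by (cases z; cases "projr z") (auto simp: Plus_def)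
  qed
  have "(\<Sum>j\<in>UNIV. f (Rep_err_index j)) = sum f (range (Rep_err_index :: ('p, 'n) err_index \<Rightarrow> _))"
    by (subst sum.reindex) (auto simp: inj_on_def Rep_err_index_inject)
  then show ?thesis
    unfolding R by (simp add: sum.Plus o_def)
qed

lemma sum_split_base:
  fixes f :: "'p::finite \<times> 'n::finite \<Rightarrow> 'a::comm_monoid_add"
  shows "(\<Sum>u\<in>UNIV. f u) = (\<Sum>k\<in>UNIV. f (base, k)) + (\<Sum>u | fst u \<noteq> base. f u)"
proof -
  have "(\<Sum>u\<in>UNIV. f u) = (\<Sum>u | fst u = base. f u) + (\<Sum>u | fst u \<noteq> base. f u)"
    by (subst sum.union_disjoint[symmetric]) (auto intro!: sum.cong)
  moreover have "{u :: 'p \<times> 'n. fst u = base} = Pair base ` UNIV" by auto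
  ultimately show ?thesis by (simp add: sum.reindex inj_on_def)
qed

lemma norm_vec_squared: "(norm x)\<^sup>2 = (\<Sum>i\<in>UNIV. (x $ i)\<^sup>2)" for x :: "real^'m::finite"
  unfolding power2_norm_eq_inner by (simp add: inner_vec_def power2_eq_square)

lemma norm_err_vec:
  "(norm (err_vec a b c))\<^sup>2 = (\<Sum>k\<in>UNIV. (a $ k)\<^sup>2) +
     ((\<Sum>u | fst u \<noteq> base. (b $ u)\<^sup>2) + (\<Sum>u | fst u \<noteq> base. (c $ u)\<^sup>2))"
proof -
  define f where "f z = (case z of Inl k \<Rightarrow> a $ k | Inr (Inl u) \<Rightarrow> b $ u | Inr (Inr u) \<Rightarrow> c $ u)\<^sup>2" for z
  have "(norm (err_vec a b c))\<^sup>2 = (\<Sum>j\<in>UNIV. f (Rep_err_index j))"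
    by (simp add: norm_vec_squared err_vec_def f_def)
  then show ?thesis unfolding sum_err_index by (simp add: f_def)
qed

lemma err_vec_add: "err_vec a b c + err_vec a' b' c' = err_vec (a + a') (b + b') (c + c')"
  by (simp add: vec_eq_iff err_vec_def split: sum.splits)

lemma err_vec_scaleR: "r *\<^sub>R err_vec a b c = err_vec (r *\<^sub>R a) (r *\<^sub>R b) (r *\<^sub>R c)"
  by (simp add: vec_eq_iff err_vec_def split: sum.splits)

lemma mat_1_nth_sum:
  fixes z :: "real^'m::finite"
  assumes "P u"
  shows "(\<Sum>w | P w. mat 1 $ u $ w * z $ w) = z $ u"
proof -
  have "(\<Sum>w | P w. mat 1 $ u $ w * z $ w) = (\<Sum>w | P w. if w = u then z $ w else 0)"
    by (rule sum.cong) (auto simp: mat_def)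
  then show ?thesis using assms by simp
qed

text \<open>The matrix A(t) contains only the entries of \<open>K\<close> away from
  \<open>base\<close>. Since the \<open>base\<close> columns of \<open>K\<close> vanish, the
  restricted sums agree with the full product \<open>K *v b\<close>, whatever the ignored block of
  \<open>b\<close> is.\<close>

lemma err_matrix_mult:
  fixes Q L :: "real^'p::finite^'p" and b :: "real^('p \<times> 'n::finite)"
  defines "K \<equiv> transpose (kron Q (mat 1 :: real^'n^'n)) ** kron L (mat 1) ** kron Q (mat 1)"
  assumes K0: "\<And>u w. fst w = base \<Longrightarrow> K $ u $ w = 0"
  shows "err_matrix \<alpha> \<beta> Q L *v err_vec a b c =
    err_vec (- \<alpha> *\<^sub>R a) (- \<alpha> *\<^sub>R b - \<beta> *\<^sub>R (K *v b) - c) ((\<alpha> * \<beta>) *\<^sub>R (K *v b))"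
proof -
  define vc where "vc = (\<lambda>z. case z of Inl k \<Rightarrow> a $ k | Inr (Inl u) \<Rightarrow> b $ u | Inr (Inr u) \<Rightarrow> c $ u)"
  define mx where "mx = (\<lambda>y z. case (y, z) of
           (Inl k, Inl m) \<Rightarrow> (- \<alpha> *\<^sub>R mat 1 :: real^'n^'n) $ k $ m
         | (Inr (Inl u), Inr (Inl w)) \<Rightarrow> (- \<alpha> *\<^sub>R mat 1 - \<beta> *\<^sub>R K) $ u $ w
         | (Inr (Inl u), Inr (Inr w)) \<Rightarrow> (- mat 1 :: real^('p \<times> 'n)^('p \<times> 'n)) $ u $ w
         | (Inr (Inr u), Inr (Inl w)) \<Rightarrow> ((\<alpha> * \<beta>) *\<^sub>R K) $ u $ w
         | _ \<Rightarrow> 0)"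
  have KB: "(\<Sum>w | fst w \<noteq> base. K $ u $ w * b $ w) = (K *v b) $ u" for u
    unfolding matrix_vector_mult_def by (auto intro!: sum.mono_neutral_left simp: K0)
  have m1: "(\<Sum>w\<in>UNIV. mat 1 $ k $ w * a $ w) = a $ k" for k
    using mat_1_nth_sum[of "\<lambda>_. True" k a] by simp
  have "(err_matrix \<alpha> \<beta> Q L *v err_vec a b c) $ j = err_vec (- \<alpha> *\<^sub>R a)
      (- \<alpha> *\<^sub>R b - \<beta> *\<^sub>R (K *v b) - c) ((\<alpha> * \<beta>) *\<^sub>R (K *v b)) $ j" for j
  proof -
    have "(err_matrix \<alpha> \<beta> Q L *v err_vec a b c) $ j =
        (\<Sum>i\<in>UNIV. (\<lambda>z. mx (Rep_err_index j) z * vc z) (Rep_err_index i))"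
      unfolding mx_def vc_def K_def by (simp add: matrix_vector_mult_def err_matrix_def Let_def err_vec_def)
    also have "\<dots> = (\<Sum>k\<in>UNIV. mx (Rep_err_index j) (Inl k) * a $ k) +
        ((\<Sum>u | fst u \<noteq> base. mx (Rep_err_index j) (Inr (Inl u)) * b $ u) +
         (\<Sum>u | fst u \<noteq> base. mx (Rep_err_index j) (Inr (Inr u)) * c $ u))"
      unfolding sum_err_index[of "\<lambda>z. mx (Rep_err_index j) z * vc z"] by (simp add: vc_def)
    also have "\<dots> = err_vec (- \<alpha> *\<^sub>R a)
      (- \<alpha> *\<^sub>R b - \<beta> *\<^sub>R (K *v b) - c) ((\<alpha> * \<beta>) *\<^sub>R (K *v b)) $ j"
    proof (cases "Rep_err_index j")
      case (Inl k)
      then show ?thesis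
        by (simp add: mx_def err_vec_def mult.assoc sum_negf m1 flip: sum_distrib_left)
    next
      case (Inr y)
      show ?thesis
      proof (cases y)
        case u: (Inl u)
        then have "fst u \<noteq> base" using Rep_err_index[of j] Inr by simp
        from mat_1_nth_sum[of "\<lambda>w. fst w \<noteq> base", OF this, of b]
          mat_1_nth_sum[of "\<lambda>w. fst w \<noteq> base", OF this, of c]
        show ?thesis
          using Inr u
          by (simp add: mx_def err_vec_def mult.assoc sum_negf left_diff_distrib sum_subtractf KB
              flip: sum_distrib_left)
      next
        case (Inr u)
        then show ?thesis using \<open>Rep_err_index j = Inr y\<close>
          by (simp add: mx_def err_vec_def mult.assoc KB flip: sum_distrib_left)
      qed
    qed
    finally show ?thesis .
  qed
  then show ?thesis by (simp add: vec_eq_iff)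
qed

section \<open>Gradients, equilibria and projections\<close>

lemma GDERIV_exists:
  fixes f :: "real^'n::finite \<Rightarrow> real"
  assumes "(f has_derivative f') (at x)"
  shows "GDERIV f x :> adjoint f' 1"
proof -
  have "linear f'" using assms has_derivative_linear by blast
  then have "f' = (\<lambda>h. h \<bullet> adjoint f' 1)"
    by (auto simp: adjoint_works)
  then show ?thesis
    using assms unfolding gderiv_def by simp
qed

lemma grad_eqI:
  assumes "GDERIV f x :> D"
  shows "grad f x = D"
  unfolding grad_def
proof (rule the_equality)
  fix D' assume "GDERIV f x :> D'"
  then have "(\<lambda>h. h \<bullet> D') = (\<lambda>h. h \<bullet> D)"
    using assms has_derivative_unique unfolding gderiv_def by blast
  then have "(D' - D) \<bullet> (D' - D) = 0"
    by (metis inner_diff_right right_minus_eq)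
  then show "D' = D" by simp
qed (rule assms)

lemma grad_works:
  assumes "(f has_derivative f') (at x)"
  shows "f' h = h \<bullet> grad f x"
proof -
  have G: "GDERIV f x :> grad f x"
    using GDERIV_exists[OF assms] grad_eqI by metis
  show ?thesis
    using has_derivative_unique[OF assms G[unfolded gderiv_def]] by simp
qed

lemma aggregate_upd:
  fixes x :: "real^('p::finite \<times> 'n::finite)"
  shows "aggregate \<phi> (upd x i y) =
    aggregate \<phi> x + (1 / real CARD('p)) *\<^sub>R (\<phi> i y - \<phi> i (blk x i))"
proof -
  have "(\<Sum>j\<in>UNIV. \<phi> j (blk (upd x i y) j)) = \<phi> i y + (\<Sum>j\<in>UNIV - {i}. \<phi> j (blk x j))"
    by (subst sum.remove[of _ i]) (auto simp: blk_upd intro!: sum.cong)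
  moreover have "(\<Sum>j\<in>UNIV. \<phi> j (blk x j)) = \<phi> i (blk x i) + (\<Sum>j\<in>UNIV - {i}. \<phi> j (blk x j))"
    by (subst sum.remove[of _ i]) auto
  ultimately show ?thesis
    by (simp add: aggregate_def scaleR_add_right[symmetric] del: scaleR_add_right)
qed

text \<open>A change of the action of player i moves the aggregate by 1/N times the change of its
  contribution. The chain rule through the pair (action, aggregate) therefore gives the partial
  gradient in the first argument plus 1/N times the transposed Jacobian applied to the one in the
  second.\<close>

lemma GDERIV_cost:
  fixes fb :: "'p::finite \<Rightarrow> real^'n::finite \<Rightarrow> real^'n \<Rightarrow> real"
  assumes fb: "\<And>i. cont_diff (\<lambda>(y, z). fb i y z)" and phi: "\<And>i. cont_diff (\<phi> i)"
  shows "GDERIV (\<lambda>y. cost fb \<phi> i (upd x i y)) (blk x i) :>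
     blk (ext_pseudo_grad fb \<phi> x (col (\<lambda>i. aggregate \<phi> x))) i"
proof -
  let ?y = "blk x i" and ?s = "aggregate \<phi> x" and ?N = "real CARD('p)"
  obtain F where F: "((\<lambda>(y, z). fb i y z) has_derivative F) (at (?y, ?s))"
    using fb[of i] unfolding cont_diff_def by blast
  obtain G where G: "(\<phi> i has_derivative G) (at ?y)"
    using phi[of i] unfolding cont_diff_def by blast
  have J: "G h = jacobian (\<phi> i) (at ?y) *v h" for h
    using G jacobian_works[of "\<phi> i"] has_derivative_unique unfolding differentiable_def by metis
  have "((\<lambda>y. (y, ?s)) has_derivative (\<lambda>h. (h, 0))) (at ?y)"
    by (auto intro!: derivative_eq_intros)
  from has_derivative_compose[OF this F]
  have F1: "((\<lambda>y. fb i y ?s) has_derivative (\<lambda>h. F (h, 0))) (at ?y)" by simp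
  have "((\<lambda>z. (?y, z)) has_derivative (\<lambda>h. (0, h))) (at ?s)"
    by (auto intro!: derivative_eq_intros)
  from has_derivative_compose[OF this F]
  have F2: "((\<lambda>z. fb i ?y z) has_derivative (\<lambda>h. F (0, h))) (at ?s)" by simp
  have c: "(\<lambda>y. cost fb \<phi> i (upd x i y)) =
      (\<lambda>y. fb i y (?s + (1 / ?N) *\<^sub>R (\<phi> i y - \<phi> i ?y)))"
    by (simp add: cost_def blk_upd aggregate_upd)
  have "((\<lambda>y. (y, ?s + (1 / ?N) *\<^sub>R (\<phi> i y - \<phi> i ?y))) has_derivative
      (\<lambda>h. (h, (1 / ?N) *\<^sub>R G h))) (at ?y)"
    by (rule derivative_eq_intros G refl | simp)+
  from has_derivative_compose[OF this, of "\<lambda>(y, z). fb i y z" F] F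
  have D: "((\<lambda>y. cost fb \<phi> i (upd x i y)) has_derivative (\<lambda>h. F (h, (1 / ?N) *\<^sub>R G h))) (at ?y)"
    unfolding c by simp
  have lin: "linear F" using F has_derivative_linear by blast
  have "F (h, (1 / ?N) *\<^sub>R G h) =
      h \<bullet> blk (ext_pseudo_grad fb \<phi> x (col (\<lambda>i. aggregate \<phi> x))) i" for h
  proof -
    \<comment> \<open>Linearity of the joint derivative separates the two partial
      derivatives.\<close>
    have "F (h, (1 / ?N) *\<^sub>R G h) = F (h, 0) + (1 / ?N) *\<^sub>R F (0, G h)"
      using linear_add[OF lin, of "(h, 0)" "(0, (1 / ?N) *\<^sub>R G h)"]
        linear_scale[OF lin, of "1 / ?N" "(0, G h)"] by simp
    also have "\<dots> = h \<bullet> grad (\<lambda>y. fb i y ?s) ?y + (1 / ?N) *\<^sub>R (G h \<bullet> grad (\<lambda>z. fb i ?y z) ?s)"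
      using grad_works[OF F1] grad_works[OF F2] by simp
    also have "G h \<bullet> grad (\<lambda>z. fb i ?y z) ?s =
        h \<bullet> (transpose (jacobian (\<phi> i) (at ?y)) *v grad (\<lambda>z. fb i ?y z) ?s)"
      by (simp add: J) (metis dot_lmul_matrix inner_commute)
    finally show ?thesis
      by (simp add: ext_pseudo_grad_def inner_add_right)
  qed
  then show ?thesis
    using D unfolding gderiv_def by simp
qed

lemma pseudo_grad_eq_ext:
  assumes "\<And>i. cont_diff (\<lambda>(y, z). fb i y z)" "\<And>i. cont_diff (\<phi> i)"
  shows "pseudo_grad fb \<phi> x = ext_pseudo_grad fb \<phi> x (col (\<lambda>i. aggregate \<phi> x))"
proof -
  have "pseudo_grad fb \<phi> x = col (blk (ext_pseudo_grad fb \<phi> x (col (\<lambda>i. aggregate \<phi> x))))"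
    unfolding pseudo_grad_def
    by (rule arg_cong[where f = col], rule ext) (rule grad_eqI[OF GDERIV_cost[OF assms]])
  then show ?thesis by (simp add: vec_eq_iff col_def)
qed

text \<open>A negative slope towards \<open>y\<close> would make \<open>f\<close> drop strictly just
  after leaving \<open>x\<close> along the segment, which stays in \<open>S\<close> by
  convexity.\<close>

lemma GDERIV_min_convex:
  fixes S :: "'a::real_inner set"
  assumes "convex S" "x \<in> S" "y \<in> S" "\<And>z. z \<in> S \<Longrightarrow> f x \<le> f z" "GDERIV f x :> D"
  shows "D \<bullet> (y - x) \<ge> 0"
proof (rule ccontr)
  assume "\<not> D \<bullet> (y - x) \<ge> 0"
  then have neg: "D \<bullet> (y - x) < 0" by simp
  have "((\<lambda>t. x + t *\<^sub>R (y - x)) has_derivative (\<lambda>t. t *\<^sub>R (y - x))) (at 0)"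
    by (auto intro!: derivative_eq_intros)
  from has_derivative_compose[OF this, of f "\<lambda>h. h \<bullet> D"] assms(5)
  have "((\<lambda>t. f (x + t *\<^sub>R (y - x))) has_derivative (\<lambda>t. t *\<^sub>R (y - x) \<bullet> D)) (at 0)"
    by (simp add: gderiv_def)
  then have "((\<lambda>t. f (x + t *\<^sub>R (y - x))) has_real_derivative (D \<bullet> (y - x))) (at 0)"
    unfolding has_field_derivative_def
    by (rule has_derivative_eq_rhs) (simp add: fun_eq_iff inner_commute)
  from DERIV_neg_dec_right[OF this neg] obtain d where d: "d > 0"
    "\<And>h. 0 < h \<Longrightarrow> h < d \<Longrightarrow> f (x + h *\<^sub>R (y - x)) < f x" by auto
  \<comment> \<open>Half of \<open>d\<close> is strictly inside the range of decrease, and the cap 1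
    keeps the point on the segment.\<close>
  define h where "h = min (d / 2) 1"
  have h: "0 < h" "h < d" "h \<le> 1" using d(1) by (auto simp: h_def)
  have "x + h *\<^sub>R (y - x) = (1 - h) *\<^sub>R x + h *\<^sub>R y" by (simp add: algebra_simps)
  then have "x + h *\<^sub>R (y - x) \<in> S"
    using assms(1-3) h unfolding convex_alt by simp
  then show False using assms(4) d(2)[OF h(1,2)] by force
qed

lemma profiles_closed_convex:
  assumes "\<And>i. closed (U i) \<and> convex (U i)"
  shows "closed (profiles U)" "convex (profiles U)"
proof -
  have eq: "profiles U = (\<Inter>i. (\<lambda>x. blk x i) -` U i)"
    by (auto simp: profiles_def)
  show "closed (profiles U)" unfolding eq
    using assms by (intro closed_INT ballI closed_vimage linear_continuous_on bounded_linear_blk) auto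
  show "convex (profiles U)" unfolding eq
    using assms by (intro convex_INT convex_linear_vimage linear_blk) auto
qed

text \<open>The set of profiles is a product, so the first-order conditions of the single players,
  each in its own block, add up to one variational inequality.\<close>

lemma nash_variational:
  assumes fb: "\<And>i. cont_diff (\<lambda>(y, z). fb i y z)" and phi: "\<And>i. cont_diff (\<phi> i)"
    and U: "\<And>i. convex (U i)" and nash: "nash_equilibrium U fb \<phi> x" and y: "y \<in> profiles U"
  shows "pseudo_grad fb \<phi> x \<bullet> (y - x) \<ge> 0"
proof -
  have "0 \<le> blk (pseudo_grad fb \<phi> x) i \<bullet> (blk y i - blk x i)" for i
  proof (rule GDERIV_min_convex[OF U])
    show "GDERIV (\<lambda>y. cost fb \<phi> i (upd x i y)) (blk x i) :> blk (pseudo_grad fb \<phi> x) i"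
      unfolding pseudo_grad_eq_ext[OF fb phi] by (rule GDERIV_cost[OF fb phi])
  qed (use nash y in \<open>auto simp: nash_equilibrium_def profiles_def\<close>)
  then show ?thesis
    by (simp add: inner_blk[of _ "y - x"] linear_diff[OF linear_blk] sum_nonneg)
qed

text \<open>The obtuse angle property of the projection, tested at \<open>x\<close>, and the
  variational inequality, tested at the projected point, together give |x - c|^2 <= 0 for that point
  c.\<close>

lemma closest_point_fixed:
  fixes S :: "'a::euclidean_space set"
  assumes "convex S" "closed S" "x \<in> S" "\<And>y. y \<in> S \<Longrightarrow> g \<bullet> (y - x) \<ge> 0" "d \<ge> 0"
  shows "closest_point S (x - d *\<^sub>R g) = x"
proof -
  let ?c = "closest_point S (x - d *\<^sub>R g)"
  have "?c \<in> S" using assms closest_point_in_set by blast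
  then have 1: "d * (g \<bullet> (?c - x)) \<ge> 0" using assms by simp
  have 2: "(x - d *\<^sub>R g - ?c) \<bullet> (x - ?c) \<le> 0"
    using closest_point_dot[OF assms(1-3)] .
  have "(x - ?c) \<bullet> (x - ?c) = (x - d *\<^sub>R g - ?c) \<bullet> (x - ?c) - d * (g \<bullet> (?c - x))"
    by (simp add: inner_diff_left inner_diff_right algebra_simps)
  then have "(x - ?c) \<bullet> (x - ?c) \<le> 0" using 1 2 by linarith
  then show ?thesis by (simp flip: power2_norm_eq_inner)
qed

section \<open>Differentiability and Lipschitz bound of the tracked signal\<close>

lemma stack_map_has_derivative:
  assumes "\<And>i. cont_diff (\<phi> i)"
  shows "(stack_map \<phi> has_derivative (\<lambda>h. jacobian (stack_map \<phi>) (at x) *v h)) (at x)"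
proof -
  have "stack_map \<phi> differentiable (at x)"
  proof (rule iffD2[OF differentiable_componentwise_within[of _ x UNIV]], rule ballI)
    fix b :: "real^('a \<times> 'b)" assume "b \<in> Basis"
    then obtain u where b: "b = axis u 1" by (auto simp: Basis_vec_def)
    obtain i k where u: "u = (i, k)" by fastforce
    obtain G where G: "(\<phi> i has_derivative G) (at (blk x i))"
      using assms[of i] unfolding cont_diff_def by blast
    have "(\<lambda>x. stack_map \<phi> x \<bullet> b) = (\<lambda>x. \<phi> i (blk x i) $ k)"
      by (simp add: b u inner_axis stack_map_def)
    moreover have "((\<lambda>x. \<phi> i (blk x i)) has_derivative (\<lambda>h. G (blk h i))) (at x)"
      using has_derivative_compose[OF bounded_linear_imp_has_derivative[OF bounded_linear_blk] G] .
    then have "((\<lambda>x. \<phi> i (blk x i) $ k) has_derivative (\<lambda>h. G (blk h i) $ k)) (at x)"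
      by (rule bounded_linear.has_derivative[OF bounded_linear_vec_nth])
    ultimately show "(\<lambda>x. stack_map \<phi> x \<bullet> b) differentiable at x"
      unfolding differentiable_def by auto
  qed
  then show ?thesis by (simp add: jacobian_works)
qed

lemma norm_matnorm: "norm (A *v z) \<le> matnorm A * norm z"
  unfolding matnorm_def by (rule onorm) (simp add: matrix_vector_mul_bounded_linear)

lemma stack_map_lipschitz:
  assumes "\<And>i. cont_diff (\<phi> i)" "\<And>z. matnorm (jacobian (stack_map \<phi>) (at z)) \<le> l"
  shows "norm (stack_map \<phi> x - stack_map \<phi> y) \<le> l * norm (x - y)"
proof (rule differentiable_bound[of UNIV "stack_map \<phi>" "\<lambda>x h. jacobian (stack_map \<phi>) (at x) *v h"])
  show "onorm ((*v) (jacobian (stack_map \<phi>) (at z))) \<le> l" for z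
    using assms(2) by (simp add: matnorm_def)
qed (use stack_map_has_derivative[where \<phi> = \<phi>, OF assms(1)] in auto)

section \<open>Estimator error and projected gradient step\<close>

lemma laplacian_row_sum: "(\<Sum>j\<in>UNIV. laplacian A $ i $ j) = 0"
  by (simp add: laplacian_def sum_subtractf)

lemma laplacian_col_sum:
  assumes "weight_balanced A"
  shows "(\<Sum>i\<in>UNIV. laplacian A $ i $ j) = 0"
  using assms by (simp add: laplacian_def sum_subtractf weight_balanced_def)

lemma kron_col_sum_zero:
  fixes L :: "real^'p::finite^'p" and z :: "real^('p \<times> 'n::finite)"
  assumes "\<And>j. (\<Sum>i\<in>UNIV. L $ i $ j) = 0"
  shows "(\<Sum>i\<in>UNIV. blk (kron L (mat 1) *v z) i) = 0"
proof -
  have "(\<Sum>i\<in>UNIV. \<Sum>j\<in>UNIV. L $ i $ j * z $ (j, k)) = 0" for k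
    by (subst sum.swap) (simp add: assms flip: sum_distrib_right)
  then show ?thesis
    by (simp add: vec_eq_iff kron_mult_nth)
qed

text \<open>Links the game to the estimator: the stacked true aggregate, where the two
  pseudo-gradients agree, is the quantity that \<open>s\<close> tracks.\<close>

lemma aggregate_avg_proj: "col (\<lambda>i. aggregate \<phi> x) = avg_proj *v stack_map \<phi> x"
  by (simp add: vec_eq_iff avg_proj_def kron_mult_nth aggregate_def stack_map_def sum_divide_distrib)

text \<open>The components r'(s - f), R's and R'(v - \<alpha> f), where f stands for the tracked signal \<phi>(x).\<close>

definition err_coord :: "real^'p^'p \<Rightarrow> real \<Rightarrow>
    (real^('p::finite \<times> 'n::finite)) \<times> (real^('p \<times> 'n)) \<times> (real^('p \<times> 'n)) \<Rightarrow> real^('p, 'n) err_index" where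
  "err_coord Q \<alpha> = (\<lambda>(s, v, f).
     err_vec (blk (qcoord Q (s - f)) base) (qcoord Q s) (qcoord Q (v - \<alpha> *\<^sub>R f)))"

lemma bounded_linear_err_coord: "bounded_linear (err_coord Q \<alpha>)"
proof -
  have "linear (err_coord Q \<alpha>)"
  proof (rule linearI)
    show "err_coord Q \<alpha> (y + z) = err_coord Q \<alpha> y + err_coord Q \<alpha> z" for y z
      by (cases y; cases z) (simp add: err_coord_def err_vec_add linear_add[OF linear_qcoord]
          linear_diff[OF linear_qcoord] linear_add[OF linear_blk] linear_diff[OF linear_blk] algebra_simps)
    show "err_coord Q \<alpha> (r *\<^sub>R y) = r *\<^sub>R err_coord Q \<alpha> y" for r y
      by (cases y) (simp add: err_coord_def err_vec_scaleR linear_scale[OF linear_qcoord]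
          linear_diff[OF linear_qcoord] linear_diff[OF linear_blk] linear_scale[OF linear_blk] algebra_simps)
  qed
  then show ?thesis by (simp add: linear_conv_bounded_linear)
qed

context
  fixes Q :: "real^'p::finite^'p"
  assumes Q: "orthogonal_matrix Q" "\<And>i. Q $ i $ base = 1 / sqrt (real CARD('p))"
begin

lemma qcoord_base: "blk (qcoord Q z) base = (1 / sqrt (real CARD('p))) *\<^sub>R (\<Sum>i\<in>UNIV. blk z i)"
  by (simp add: vec_eq_iff qcoord_nth Q(2) sum_divide_distrib)

text \<open>Averaging is the orthogonal projection onto the profiles with equal blocks, which are
  exactly those spanned by r. In the coordinates of \<open>Q\<close> it therefore keeps the
  \<open>base\<close> block and removes the others.\<close>

lemma qcoord_avg_proj:
  "qcoord Q (avg_proj *v z) $ (i, k) = (if i = base then qcoord Q z $ (base, k) else 0)"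
proof -
  let ?N = "real CARD('p)"
  have "(transpose Q ** Q) $ i $ base = mat 1 $ i $ base"
    using Q(1) by (simp add: orthogonal_matrix)
  then have o: "(\<Sum>j\<in>UNIV. Q $ j $ i * (1 / sqrt ?N)) = (if i = base then 1 else 0)"
    by (simp add: matrix_matrix_mult_def transpose_def mat_def Q(2))
  \<comment> \<open>Splitting 1/N writes averaging as r r', so that orthogonality of the columns of
    \<open>Q\<close> applies.\<close>
  have n: "1 / ?N = (1 / sqrt ?N) * (1 / sqrt ?N)" by simp
  have "(avg_proj *v z) $ (j, k) = (1 / sqrt ?N) * ((1 / sqrt ?N) * (\<Sum>m\<in>UNIV. z $ (m, k)))" for j
    unfolding avg_proj_def kron_mult_nth
    by (simp add: sum_distrib_left[symmetric] n mult.assoc del: times_divide_eq_left times_divide_eq_right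
        divide_divide_eq_left real_sqrt_mult_self)
  then have "qcoord Q (avg_proj *v z) $ (i, k) =
      (\<Sum>j\<in>UNIV. Q $ j $ i * (1 / sqrt ?N)) * ((1 / sqrt ?N) * (\<Sum>m\<in>UNIV. z $ (m, k)))"
    unfolding qcoord_nth sum_distrib_right by (simp only: mult.assoc)
  also have "\<dots> = (if i = base then qcoord Q z $ (base, k) else 0)"
    unfolding o by (simp add: qcoord_nth Q(2) sum_divide_distrib)
  finally show ?thesis .
qed

text \<open>In orthogonal coordinates both left-hand sides are partial sums of the squared norm of
  the error vector: the first consists of its first two blocks, the second of its last block. For
  the second, the \<open>base\<close> component of \<open>v\<close> has to vanish, since the error
  vector does not record it.\<close>

lemma norm_err_coord_ge:
  fixes s v f :: "real^('p \<times> 'n::finite)"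
  shows "norm (s - avg_proj *v f) \<le> norm (err_coord Q \<alpha> (s, v, f))"
    and "(\<Sum>i\<in>UNIV. blk v i) = 0 \<Longrightarrow>
      norm (v - \<alpha> *\<^sub>R (f - avg_proj *v f)) \<le> norm (err_coord Q \<alpha> (s, v, f))"
proof -
  have d: "qcoord Q (y - z) = qcoord Q y - qcoord Q z" "qcoord Q (r *\<^sub>R y) = r *\<^sub>R qcoord Q y"
    for r and y z :: "real^('p \<times> 'n)"
    by (rule linear_diff[OF linear_qcoord] linear_scale[OF linear_qcoord])+
  let ?e = "err_coord Q \<alpha> (s, v, f)"
  let ?a = "\<Sum>k\<in>UNIV. ((qcoord Q s - qcoord Q f) $ (base, k))\<^sup>2"
  let ?b = "\<Sum>u | fst u \<noteq> base. (qcoord Q s $ u)\<^sup>2"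
  let ?c = "\<Sum>u | fst u \<noteq> base. ((qcoord Q v - \<alpha> *\<^sub>R qcoord Q f) $ u)\<^sup>2"
  have e: "(norm ?e)\<^sup>2 = ?a + (?b + ?c)"
    by (simp add: err_coord_def norm_err_vec d)
  have nn: "?a \<ge> 0" "?b \<ge> 0" "?c \<ge> 0" by (auto intro: sum_nonneg)
  have "(norm (s - avg_proj *v f))\<^sup>2 = (norm (qcoord Q (s - avg_proj *v f)))\<^sup>2"
    by (simp add: norm_qcoord[OF Q(1)])
  also have "\<dots> = ?a + ?b"
    unfolding norm_vec_squared sum_split_base
    by (auto simp: d qcoord_avg_proj intro!: arg_cong2[where f = "(+)"] sum.cong)
  finally have "(norm (s - avg_proj *v f))\<^sup>2 \<le> (norm ?e)\<^sup>2" using e nn by simp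
  then show "norm (s - avg_proj *v f) \<le> norm ?e" by (rule power2_le_imp_le) simp
  assume "(\<Sum>i\<in>UNIV. blk v i) = 0"
  then have "blk (qcoord Q v) base = 0" by (simp add: qcoord_base)
  then have v0: "qcoord Q v $ (base, k) = 0" for k
    by (metis blk_nth zero_index)
  have "(norm (v - \<alpha> *\<^sub>R (f - avg_proj *v f)))\<^sup>2 = (norm (qcoord Q (v - \<alpha> *\<^sub>R (f - avg_proj *v f))))\<^sup>2"
    by (simp add: norm_qcoord[OF Q(1)])
  also have "\<dots> = ?c"
    unfolding norm_vec_squared sum_split_base
    by (auto simp: d qcoord_avg_proj v0 intro!: sum.cong)
  finally have "(norm (v - \<alpha> *\<^sub>R (f - avg_proj *v f)))\<^sup>2 \<le> (norm ?e)\<^sup>2" using e nn by simp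
  then show "norm (v - \<alpha> *\<^sub>R (f - avg_proj *v f)) \<le> norm ?e" by (rule power2_le_imp_le) simp
qed

text \<open>The signal enters with factor 1 along r, not at all in the middle block, and with factor
  \<alpha> in the last block; both squared weights are at most
  \<open>\<alpha>\<^sup>2 + 1\<close>.\<close>

lemma norm_err_coord_input:
  "norm (err_coord Q \<alpha> (0, 0, f)) \<le> sqrt (\<alpha>\<^sup>2 + 1) * norm f"
proof (rule power2_le_imp_le)
  let ?a = "\<Sum>k\<in>UNIV. (qcoord Q f $ (base, k))\<^sup>2"
  let ?c = "\<Sum>u | fst u \<noteq> base. (qcoord Q f $ u)\<^sup>2"
  have nn: "?a \<ge> 0" "?c \<ge> 0" by (auto intro: sum_nonneg)
  have "(norm (err_coord Q \<alpha> (0, 0, f)))\<^sup>2 = ?a + \<alpha>\<^sup>2 * ?c"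
    by (simp add: err_coord_def norm_err_vec linear_neg[OF linear_qcoord] linear_scale[OF linear_qcoord]
        linear_0[OF linear_qcoord] power_mult_distrib sum_distrib_left)
  also have "\<dots> \<le> (\<alpha>\<^sup>2 + 1) * (?a + ?c)"
    using nn by (simp add: algebra_simps)
  also have "?a + ?c = (norm f)\<^sup>2"
    by (subst norm_qcoord[OF Q(1), symmetric]) (simp add: norm_vec_squared sum_split_base[of "\<lambda>u. (qcoord Q f $ u)\<^sup>2"])
  finally show "(norm (err_coord Q \<alpha> (0, 0, f)))\<^sup>2 \<le> (sqrt (\<alpha>\<^sup>2 + 1) * norm f)\<^sup>2"
    by (simp add: power_mult_distrib)
qed simp

text \<open>Along r the terms with \<open>L\<close> and \<open>v\<close> vanish by the column sums
  and the zero sum of \<open>v\<close>. On the complement, the drive \<alpha> f of \<open>s\<close>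
  combines with - v into minus the third error component, which leaves only f' as input.\<close>

lemma err_coord_dynamics:
  fixes s v f f' :: "real^('p \<times> 'n::finite)"
  assumes row: "\<And>i. (\<Sum>j\<in>UNIV. L $ i $ j) = 0" and col: "\<And>j. (\<Sum>i\<in>UNIV. L $ i $ j) = 0"
    and v: "(\<Sum>i\<in>UNIV. blk v i) = 0"
  shows "err_coord Q \<alpha> (- \<alpha> *\<^sub>R (s - f) - \<beta> *\<^sub>R (kron L (mat 1 :: real^'n^'n) *v s) - v,
      (\<alpha> * \<beta>) *\<^sub>R (kron L (mat 1 :: real^'n^'n) *v s), f') =
    err_matrix \<alpha> \<beta> Q L *v err_coord Q \<alpha> (s, v, f) + err_coord Q \<alpha> (0, 0, f')"
proof -
  let ?I = "mat 1 :: real^'n^'n"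
  let ?QQ = "kron Q ?I"
  let ?L = "kron L ?I"
  define K where "K = transpose ?QQ ** ?L ** ?QQ"
  \<comment> \<open>\<open>Q\<close> maps the \<open>base\<close> block to profiles with equal
    blocks, and these are annihilated by \<open>L\<close> because its row sums vanish.\<close>
  have K0: "K $ u $ w = 0" if "fst w = base" for u w
  proof -
    have "(?QQ *v axis w 1) $ (j, k) = Q $ j $ base * axis w 1 $ (base, k)" for j k
    proof -
      have "(?QQ *v axis w 1) $ (j, k) = (\<Sum>m\<in>UNIV. if m = base then Q $ j $ m * axis w 1 $ (m, k) else 0)"
        unfolding kron_mult_nth using that by (intro sum.cong) (auto simp: axis_def)
      then show ?thesis by simp
    qed
    then have "(?L *v (?QQ *v axis w 1)) $ (i, k) = 0" for i k
      using row[of i] by (simp add: kron_mult_nth Q(2) flip: sum_distrib_right sum_divide_distrib)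
    then have "?L *v (?QQ *v axis w 1) = 0" by (simp add: vec_eq_iff)
    then have "K *v axis w 1 = 0"
      unfolding K_def matrix_vector_mul_assoc[symmetric] by (simp del: transpose_matrix_vector)
    then show ?thesis
      by (metis cart_eq_inner_axis matrix_vector_mul_component matrix_mult_dot zero_index)
  qed
  have Kq: "K *v qcoord Q s = qcoord Q (?L *v s)"
    unfolding K_def matrix_vector_mul_assoc[symmetric] kron_qcoord[OF Q(1)]
    by (simp only: qcoord_def)
  have Lb: "blk (qcoord Q (?L *v s)) base = 0"
    by (simp add: qcoord_base kron_col_sum_zero[OF col])
  have vb: "blk (qcoord Q v) base = 0"
    by (simp add: qcoord_base v)
  have q: "qcoord Q (y - z) = qcoord Q y - qcoord Q z" "qcoord Q (y + z) = qcoord Q y + qcoord Q z"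
    "qcoord Q (r *\<^sub>R y) = r *\<^sub>R qcoord Q y" "qcoord Q (- y) = - qcoord Q y"
    for r and y z :: "real^('p \<times> 'n)"
    by (rule linear_diff[OF linear_qcoord] linear_scale[OF linear_qcoord] linear_add[OF linear_qcoord]
        linear_neg[OF linear_qcoord])+
  have b: "blk (y - z) i = blk y i - blk z i" "blk (y + z) i = blk y i + blk z i"
    "blk (r *\<^sub>R y) i = r *\<^sub>R blk y i" "blk (- y) i = - blk y i"
    for r i and y z :: "real^('p \<times> 'n)"
    by (simp_all add: vec_eq_iff)
  have M: "err_matrix \<alpha> \<beta> Q L *v err_vec a (qcoord Q s) c =
      err_vec (- \<alpha> *\<^sub>R a) (- \<alpha> *\<^sub>R qcoord Q s - \<beta> *\<^sub>R (K *v qcoord Q s) - c)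
        ((\<alpha> * \<beta>) *\<^sub>R (K *v qcoord Q s))" for a c
    unfolding K_def by (rule err_matrix_mult) (rule K0[unfolded K_def])
  show ?thesis
    unfolding err_coord_def prod.case M Kq err_vec_add
    by (simp add: q b Lb vb linear_0[OF linear_qcoord] algebra_simps)
qed

end

text \<open>The step with the exact operator, \<open>y'\<close>, is the intermediate point.
  Nonexpansiveness of the projection bounds its distance to the fixed point by \<open>w\<close>, and
  its distance to the actual step by \<open>d * e\<close>.\<close>

lemma projected_step_estimates:
  fixes F :: "'a::euclidean_space \<Rightarrow> 'a"
  assumes S: "convex S" "closed S" and zS: "z \<in> S"
    and fixed: "closest_point S (z0 - d *\<^sub>R F z0) = z0"
    and mono: "(z - z0) \<bullet> (F z - F z0) \<ge> \<mu> * (norm (z - z0))\<^sup>2"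
    and lip: "norm (F z - F z0) \<le> \<theta> * norm (z - z0)"
    and g: "norm (g - F z) \<le> e"
    and d: "d > 0" "\<theta> > 0" "d * \<theta>\<^sup>2 \<le> 2 * \<mu>"
  shows "(z - z0) \<bullet> (closest_point S (z - d *\<^sub>R g) - z) \<le>
      - k1 \<mu> \<theta> d * (norm (z - z0))\<^sup>2 + d * e * norm (z - z0)" (is ?A)
    and "norm (closest_point S (z - d *\<^sub>R g) - z) \<le> (2 + d * \<theta>) * norm (z - z0) + d * e" (is ?B)
proof -
  define r where "r = norm (z - z0)"
  define c where "c = d * (2 * \<mu> - d * \<theta>\<^sup>2)"
  define y where "y = closest_point S (z - d *\<^sub>R g)"
  define y' where "y' = closest_point S (z - d *\<^sub>R F z)"
  define D where "D = F z - F z0"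
  define w where "w = norm (z - z0 - d *\<^sub>R D)"
  have ne: "S \<noteq> {}" using zS by auto
  have r0: "r \<ge> 0" by (simp add: r_def)
  have c0: "c \<ge> 0" using d by (simp add: c_def)
  have "norm (y' - z0) = dist (closest_point S (z - d *\<^sub>R F z)) (closest_point S (z0 - d *\<^sub>R F z0))"
    unfolding fixed by (simp add: y'_def dist_norm)
  also have "\<dots> \<le> dist (z - d *\<^sub>R F z) (z0 - d *\<^sub>R F z0)"
    by (rule closest_point_lipschitz[OF S ne])
  also have "\<dots> = w" by (simp add: w_def dist_norm D_def algebra_simps)
  finally have y'w: "norm (y' - z0) \<le> w" .
  have "norm (y - y') \<le> dist (z - d *\<^sub>R g) (z - d *\<^sub>R F z)"
    unfolding y_def y'_def dist_norm[symmetric] by (rule closest_point_lipschitz[OF S ne])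
  also have "\<dots> = d * norm (g - F z)"
    using d(1) by (simp add: dist_norm norm_minus_commute flip: scaleR_diff_right)
  also have "\<dots> \<le> d * e" using g d(1) by simp
  finally have yy: "norm (y - y') \<le> d * e" .
  have D: "norm D \<le> \<theta> * r" using lip by (simp add: D_def r_def)
  have w1: "w \<le> (1 + d * \<theta>) * r"
  proof -
    have "w \<le> r + d * norm D"
      unfolding w_def r_def using norm_triangle_ineq4[of "z - z0" "d *\<^sub>R D"] d(1) by simp
    also have "\<dots> \<le> r + d * (\<theta> * r)" using D d(1) by simp
    finally show ?thesis by (simp add: algebra_simps)
  qed
  have w2: "w\<^sup>2 \<le> (1 - c) * r\<^sup>2"
  proof -
    have "w\<^sup>2 = r\<^sup>2 - 2 * d * ((z - z0) \<bullet> D) + d\<^sup>2 * (norm D)\<^sup>2"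
      unfolding w_def r_def power2_norm_eq_inner
      by (simp add: inner_diff_left inner_diff_right inner_commute power2_eq_square algebra_simps)
    also have "\<dots> \<le> r\<^sup>2 - 2 * d * (\<mu> * r\<^sup>2) + d\<^sup>2 * (\<theta> * r)\<^sup>2"
      using mono d(1) D by (intro add_mono diff_mono mult_left_mono power_mono) (auto simp: r_def D_def)
    also have "\<dots> = (1 - c) * r\<^sup>2" by (simp add: c_def power2_eq_square algebra_simps)
    finally show ?thesis .
  qed
  \<comment> \<open>The argument yields the rate \<open>c / 2\<close>; the divisor
    \<open>2 + d * \<theta>\<close> in \<open>k1\<close> is at least 2, so \<open>k1\<close> is a
    lower bound for it.\<close>
  have k1: "k1 \<mu> \<theta> d \<le> c / 2"
    unfolding k1_def c_def[symmetric] using c0 d by (intro divide_left_mono) (auto intro: add_pos_pos)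
  have 1: "(z - z0) \<bullet> (y' - z) \<le> - k1 \<mu> \<theta> d * r\<^sup>2"
  proof -
    have "(z - z0) \<bullet> (y' - z) = (z - z0) \<bullet> (y' - z0) - r\<^sup>2"
      unfolding r_def power2_norm_eq_inner by (simp add: inner_diff_right)
    also have "(z - z0) \<bullet> (y' - z0) \<le> r * w"
      using norm_cauchy_schwarz[of "z - z0" "y' - z0"] mult_left_mono[OF y'w r0] by (simp add: r_def)
    \<comment> \<open>The arithmetic-geometric mean inequality lets the bound on
      \<open>w\<^sup>2\<close> be used without a square root.\<close>
    also have "r * w \<le> (r\<^sup>2 + w\<^sup>2) / 2"
      using sum_squares_bound[of r w] by simp
    also have "(r\<^sup>2 + w\<^sup>2) / 2 - r\<^sup>2 \<le> - (c / 2) * r\<^sup>2"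
      using w2 by (simp add: algebra_simps)
    also have "\<dots> \<le> - k1 \<mu> \<theta> d * r\<^sup>2"
      using k1 by (intro mult_right_mono) auto
    finally show ?thesis by simp
  qed
  have "(z - z0) \<bullet> (y - z) = (z - z0) \<bullet> (y' - z) + (z - z0) \<bullet> (y - y')"
    by (simp add: inner_diff_right)
  also have "(z - z0) \<bullet> (y - y') \<le> r * (d * e)"
    using norm_cauchy_schwarz[of "z - z0" "y - y'"] mult_left_mono[OF yy r0] by (simp add: r_def)
  finally show ?A using 1 by (simp add: y_def r_def algebra_simps)
  have "norm (y - z) \<le> norm (y - y') + norm (y' - z0) + norm (z0 - z)"
    by (smt (verit, ccfv_threshold) diff_add_cancel add_diff_eq norm_triangle_ineq)
  then show ?B
    using yy y'w w1 by (simp add: y_def r_def norm_minus_commute algebra_simps)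
qed

section \<open>Lyapunov analysis of the closed loop\<close>

text \<open>Clearing the denominator gives d k2^2 < k1 (1 - d k3). Its left side is nonnegative,
  which forces the second factor to be positive; multiplication by d gives the determinant condition
  for the quadratic form.\<close>

lemma small_gain:
  fixes k1 k2 k3 d :: real
  assumes "k1 > 0" "k2 > 0" "k3 \<ge> 0" "d > 0" "d < k1 / (k1 * k3 + k2\<^sup>2)"
  shows "1 - d * k3 > 0" "(d * k2)\<^sup>2 < (d * k1) * (1 - d * k3)"
proof -
  have "k1 * k3 + k2\<^sup>2 > 0" using assms by (simp add: add_nonneg_pos)
  then have lt: "d * (k1 * k3 + k2\<^sup>2) < k1"
    using assms(5) by (simp add: pos_less_divide_eq)
  then have "d * k2\<^sup>2 < k1 * (1 - d * k3)" by (simp add: algebra_simps)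
  moreover have "d * k2\<^sup>2 \<ge> 0" using assms by simp
  ultimately show "1 - d * k3 > 0" using assms(1) by (smt (verit) mult_nonneg_nonpos)
  from \<open>d * k2\<^sup>2 < k1 * (1 - d * k3)\<close> have "d * (d * k2\<^sup>2) < d * (k1 * (1 - d * k3))"
    using assms(4) by (rule mult_strict_left_mono)
  then show "(d * k2)\<^sup>2 < (d * k1) * (1 - d * k3)"
    by (simp add: power2_eq_square algebra_simps)
qed

theorem theorem1:
  fixes U :: "'p::finite \<Rightarrow> (real^'n::finite) set"
    and fb :: "'p \<Rightarrow> real^'n \<Rightarrow> real^'n \<Rightarrow> real"
    and \<phi> :: "'p \<Rightarrow> real^'n \<Rightarrow> real^'n"
    and n0 :: nat and ts :: "nat \<Rightarrow> real" and \<rho> :: "real \<Rightarrow> nat"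
    and E :: "nat \<Rightarrow> ('p \<times> 'p) set" and Adj :: "nat \<Rightarrow> real^'p^'p"
    and Lap :: "real \<Rightarrow> real^'p^'p" and Q :: "real^'p^'p"
    and H :: "real \<Rightarrow> real^('p, 'n) err_index^('p, 'n) err_index"
    and xstar :: "real^('p \<times> 'n)" and x s v :: "real \<Rightarrow> real^('p \<times> 'n)"
    and \<mu> \<theta> \<theta>h l \<alpha> \<beta> p \<delta>1 \<delta>2 :: real
  assumes smooth_cost: "\<And>i. cont_diff (\<lambda>(y, z). fb i y z)"
    and smooth_phi: "\<And>i. cont_diff (\<phi> i)"
    and switching: "switching_signal n0 ts \<rho>"
    and adjacency: "\<And>k. k \<in> {1..n0} \<Longrightarrow> weighted_adjacency (E k) (Adj k)"
    and Lap: "\<And>t. Lap t = laplacian (Adj (\<rho> t))"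
    and A1_sets: "\<And>i. U i \<noteq> {} \<and> closed (U i) \<and> convex (U i)"
    and A1_convex: "\<And>i z. \<forall>j. j \<noteq> i \<longrightarrow> blk z j \<in> U j \<Longrightarrow>
          convex_on (U i) (\<lambda>y. cost fb \<phi> i (upd z i y)) \<and>
          cont_diff (\<lambda>y. cost fb \<phi> i (upd z i y))"
    and A1_monotone: "\<mu> > 0"
        "\<forall>z\<in>profiles U. \<forall>z'\<in>profiles U.
           (z - z') \<bullet> (pseudo_grad fb \<phi> z - pseudo_grad fb \<phi> z') \<ge> \<mu> * (norm (z - z'))\<^sup>2"
    and A2: "\<theta> > 0"
        "\<forall>z\<in>profiles U. \<forall>z'\<in>profiles U.
           norm (pseudo_grad fb \<phi> z - pseudo_grad fb \<phi> z') \<le> \<theta> * norm (z - z')"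
    and A3_ext: "\<theta>h > 0"
        "\<And>z w w'. norm (ext_pseudo_grad fb \<phi> z w - ext_pseudo_grad fb \<phi> z w') \<le> \<theta>h * norm (w - w')"
    and A3_phi: "l > 0" "\<And>z. matnorm (jacobian (stack_map \<phi>) (at z)) \<le> l"
    and A4_connected: "\<exists>T>0. \<forall>t\<ge>0. digraph_connected (union_edges E \<rho> ts t T)"
    and A4_balanced: "\<forall>t\<ge>0. weight_balanced (Adj (\<rho> t))"
    and nash: "nash_equilibrium U fb \<phi> xstar"
    and gains: "\<alpha> > 0" "\<beta> > 0"
    and Q: "orthogonal_matrix Q" "\<And>i. Q $ i $ base = 1 / sqrt (real CARD('p))"
    and H: "lyapunov_matrix \<alpha> \<beta> Q Lap ts H"
    and p: "p > 0" "\<forall>t\<ge>0. matnorm (H t) \<le> p"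
    and delta1: "0 < \<delta>1" "\<delta>1 < delta1_bound \<mu> \<theta>"
    and delta2: "0 < \<delta>2" "\<delta>2 < delta2_bound \<mu> \<theta> \<theta>h (M_const p l \<alpha>) \<delta>1"
    and solution: "closed_loop_solution U fb \<phi> \<alpha> \<beta> \<delta>1 \<delta>2 Lap ts x s v"
    and init: "\<And>i. blk (x 0) i \<in> U i" "(\<Sum>i\<in>UNIV. blk (v 0) i) = 0"
  shows "converges_exponentially (\<lambda>t. (x t, s t, v t))
           (xstar,
            avg_proj *v stack_map \<phi> xstar,
            \<alpha> *\<^sub>R ((mat 1 - avg_proj) *v stack_map \<phi> xstar))"
proof -
  let ?I = "mat 1 :: real^'n^'n"
  let ?S = "profiles U" and ?F = "pseudo_grad fb \<phi>" and ?f = "stack_map \<phi>"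
  let ?P = "avg_proj :: real^('p \<times> 'n)^('p \<times> 'n)"
  define M where "M = M_const p l \<alpha>"
  define A where "A t = (err_matrix \<alpha> \<beta> Q (Lap t) :: real^('p, 'n) err_index^('p, 'n) err_index)" for t
  define G where "G t = ext_pseudo_grad fb \<phi> (x t) (s t)" for t
  define xd where "xd t = \<delta>2 *\<^sub>R (closest_point ?S (x t - \<delta>1 *\<^sub>R G t) - x t)" for t
  define fd where "fd t = jacobian ?f (at (x t)) *v xd t" for t
  define z where "z t = err_coord Q \<alpha> (s t, v t, ?f (x t))" for t
  define I where "I j = {ts j..<ts (Suc j)}" for j
  have S: "closed ?S" "convex ?S" using A1_sets by (auto intro!: profiles_closed_convex)
  have cont: "continuous_on {0..} x" "continuous_on {0..} s" "continuous_on {0..} v"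
    using solution by (auto simp: closed_loop_solution_def)
  have dx: "(x has_vector_derivative xd t) (at t within I j)"
    and ds: "(s has_vector_derivative - \<alpha> *\<^sub>R (s t - ?f (x t)) - \<beta> *\<^sub>R (kron (Lap t) ?I *v s t) - v t) (at t within I j)"
    and dv: "(v has_vector_derivative (\<alpha> * \<beta>) *\<^sub>R (kron (Lap t) ?I *v s t)) (at t within I j)"
    if "t \<in> I j" for t j
    using solution that unfolding closed_loop_solution_def xd_def G_def I_def by blast+
  have I_nonneg: "t \<ge> 0" if "t \<in> I j" for t j
  proof -
    have "ts k \<ge> 0" for k
    proof (induction k)
      case (Suc k)
      have "ts k \<le> ts (Suc k)" using switching unfolding switching_signal_def by (smt (verit))
      then show ?case using Suc by simp
    qed (use switching in \<open>simp add: switching_signal_def\<close>)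
    then show ?thesis using that by (auto simp: I_def intro: order_trans)
  qed
  have row: "(\<Sum>j\<in>UNIV. Lap t $ i $ j) = 0" for t i
    by (simp add: Lap laplacian_row_sum)
  have col: "(\<Sum>i\<in>UNIV. Lap t $ i $ j) = 0" if "t \<ge> 0" for t j
    using A4_balanced that by (simp add: Lap laplacian_col_sum)

  \<comment> \<open>Strong monotonicity and the Lipschitz bound of the pseudo-gradient are available
    on the strategy set only, so the trajectory has to be confined to it before any
    estimate.\<close>
  have xS: "x t \<in> ?S" if "t \<ge> 0" for t
  proof (rule projected_flow_invariant[OF switching cont(1) _ S(2,1) _ _ delta2(1) that])
    show "x 0 \<in> ?S" using init(1) by (simp add: profiles_def)
    then show "closest_point ?S (x t - \<delta>1 *\<^sub>R G t) \<in> ?S" for t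
      using S(1) by (intro closest_point_in_set) auto
  qed (use dx in \<open>simp add: xd_def I_def\<close>)

  have vsum: "(\<Sum>i\<in>UNIV. blk (v t) i) = 0" if "t \<ge> 0" for t
  proof -
    have "(\<Sum>i\<in>UNIV. blk (v t) i) = (\<Sum>i\<in>UNIV. blk (v 0) i)"
    proof (rule piecewise_constant[OF switching _ _ that])
      show "continuous_on {0..} (\<lambda>t. \<Sum>i\<in>UNIV. blk (v t) i)"
        by (intro continuous_intros bounded_linear.continuous_on[OF bounded_linear_blk] cont)
      fix j t assume "t \<in> {ts j..<ts (Suc j)}"
      then have t: "t \<in> I j" by (simp add: I_def)
      have "bounded_linear (\<lambda>y :: real^('p \<times> 'n). \<Sum>i\<in>UNIV. blk y i)"
        by (intro bounded_linear_sum bounded_linear_blk)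
      from bounded_linear.has_vector_derivative[OF this dv[OF t]]
      show "((\<lambda>t. \<Sum>i\<in>UNIV. blk (v t) i) has_vector_derivative 0) (at t within {ts j..<ts (Suc j)})"
        using kron_col_sum_zero[of "Lap t" "s t", OF col[OF I_nonneg[OF t]]]
        by (simp add: I_def linear_scale[OF linear_blk] flip: scaleR_sum_right)
    qed
    then show ?thesis by (simp add: init(2))
  qed

  \<comment> \<open>Linear dynamics of the estimator error\<close>
  have dz: "(z has_vector_derivative A t *v z t + err_coord Q \<alpha> (0, 0, fd t)) (at t within I j)"
    if t: "t \<in> I j" for t j
  proof -
    have "((\<lambda>t. ?f (x t)) has_vector_derivative fd t) (at t within I j)"
    proof -
      have "((\<lambda>t. ?f (x t)) has_derivative (\<lambda>h. jacobian ?f (at (x t)) *v (h *\<^sub>R xd t))) (at t within I j)"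
        by (rule has_derivative_compose[OF dx[OF t, unfolded has_vector_derivative_def]
            stack_map_has_derivative[where \<phi> = \<phi>, OF smooth_phi]])
      then show ?thesis
        by (simp add: has_vector_derivative_def fd_def matrix_vector_mult_scaleR)
    qed
    from bounded_linear.has_vector_derivative[OF bounded_linear_err_coord[of Q \<alpha>]
        has_vector_derivative_Pair[OF ds[OF t] has_vector_derivative_Pair[OF dv[OF t] this]]]
    show ?thesis
      unfolding z_def A_def err_coord_dynamics[OF Q row col[OF I_nonneg[OF t]] vsum[OF I_nonneg[OF t]]] .
  qed

  obtain h1 h2 where h: "h1 > 0" "h2 > 0"
    "\<And>t y. t \<ge> 0 \<Longrightarrow> h1 * (norm y)\<^sup>2 \<le> y \<bullet> (H t *v y) \<and> y \<bullet> (H t *v y) \<le> h2 * (norm y)\<^sup>2"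
    and Hc: "continuous_on {0..} H" and Hsym: "\<And>t. t \<ge> 0 \<Longrightarrow> transpose (H t) = H t"
    and dH: "\<And>j t. t \<in> I j \<Longrightarrow>
      (H has_vector_derivative - (transpose (A t) ** H t + H t ** A t + mat 1)) (at t within I j)"
    using H unfolding lyapunov_matrix_def I_def A_def by blast

  define V where "V t = (norm (x t - xstar))\<^sup>2 / 2 + z t \<bullet> (H t *v z t)" for t
  \<comment> \<open>The dissipation estimate comes in plain norms; the bounds \<open>h1\<close> and
    \<open>h2\<close> make \<open>W\<close> comparable with \<open>V\<close> from both
    sides.\<close>
  define W where "W t = (norm (x t - xstar))\<^sup>2 + (norm (z t))\<^sup>2" for t
  have M: "M > 0"
    unfolding M_def M_const_def using p(1) A3_phi(1)
    by (intro mult_pos_pos) (auto intro: add_nonneg_pos)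
  have k1: "k1 \<mu> \<theta> \<delta>1 > 0"
    using delta1 A2(1) unfolding k1_def delta1_bound_def
    by (intro divide_pos_pos mult_pos_pos) (auto simp: field_simps intro: add_pos_pos)
  have k2: "k2 \<theta> \<theta>h M \<delta>1 > 0"
    using delta1(1) A2(1) A3_ext(1) M unfolding k2_def
    by (intro divide_pos_pos add_pos_pos mult_pos_pos) auto
  have k3: "k3 \<theta>h M \<delta>1 \<ge> 0"
    using delta1(1) A3_ext(1) M unfolding k3_def by simp
  note gain = small_gain[OF k1 k2 k3 delta2(1) delta2(2)[unfolded delta2_bound_def M_def[symmetric]]]
  obtain e where e: "e > 0" "\<And>a b. e * (a\<^sup>2 + b\<^sup>2) \<le>
      \<delta>2 * k1 \<mu> \<theta> \<delta>1 * a\<^sup>2 - 2 * (\<delta>2 * k2 \<theta> \<theta>h M \<delta>1) * a * b + (1 - \<delta>2 * k3 \<theta>h M \<delta>1) * b\<^sup>2"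
    using quadratic_form_pos_def[OF mult_pos_pos[OF delta2(1) k1] gain] by metis

  \<comment> \<open>Dissipation inequality on a switching interval\<close>
  have dV: "\<exists>D. (V has_vector_derivative D) (at t within I j) \<and> D \<le> - e * W t" if t: "t \<in> I j" for t j
  proof -
    have t0: "t \<ge> 0" using I_nonneg[OF t] .
    define a where "a = norm (x t - xstar)"
    define b where "b = norm (z t)"
    define g where "g = err_coord Q \<alpha> (0, 0, fd t)"
    define D where "D = (x t - xstar) \<bullet> xd t + (- (norm (z t))\<^sup>2 + 2 * (g \<bullet> (H t *v z t)))"
    have nn: "a \<ge> 0" "b \<ge> 0" by (simp_all add: a_def b_def)
    have "((\<lambda>t. x t - xstar) has_vector_derivative xd t) (at t within I j)"
      using dx[OF t] by (auto intro!: derivative_eq_intros)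
    from bounded_bilinear.has_vector_derivative[OF bounded_bilinear_inner this this]
    have "((\<lambda>t. (norm (x t - xstar))\<^sup>2) has_vector_derivative 2 * ((x t - xstar) \<bullet> xd t)) (at t within I j)"
      unfolding power2_norm_eq_inner by (simp add: inner_commute)
    from has_vector_derivative_divide[OF this, of 2]
    have "((\<lambda>t. (norm (x t - xstar))\<^sup>2 / 2) has_vector_derivative (x t - xstar) \<bullet> xd t) (at t within I j)"
      by simp
    from has_vector_derivative_add[OF this
        has_vector_derivative_quadratic_form[OF dH[OF t] dz[OF t] Hsym[OF t0]]]
    have der: "(V has_vector_derivative D) (at t within I j)"
      unfolding V_def D_def g_def .
    \<comment> \<open>The gradient error is the effect of replacing the true aggregate by the
      estimate \<open>s t\<close>, whose error is a part of \<open>z t\<close>. The value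
      \<open>\<theta>h * b\<close> becomes the perturbation \<open>e\<close> of the projected
      step.\<close>
    have eG: "norm (G t - ?F (x t)) \<le> \<theta>h * b"
    proof -
      have "norm (G t - ?F (x t)) \<le> \<theta>h * norm (s t - ?P *v ?f (x t))"
        unfolding G_def pseudo_grad_eq_ext[OF smooth_cost smooth_phi] aggregate_avg_proj by (rule A3_ext(2))
      also have "\<dots> \<le> \<theta>h * b"
        using norm_err_coord_ge(1)[OF Q] A3_ext(1) by (simp add: b_def z_def)
      finally show ?thesis .
    qed
    have xstar: "xstar \<in> ?S" using nash by (simp add: nash_equilibrium_def)
    \<comment> \<open>The equilibrium solves the variational inequality, hence is a fixed point of
      the exact projected step and can serve as its centre of contraction.\<close>
    have "closest_point ?S (xstar - \<delta>1 *\<^sub>R ?F xstar) = xstar"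
      using nash_variational[OF smooth_cost smooth_phi _ nash] A1_sets delta1(1)
      by (intro closest_point_fixed S xstar) auto
    moreover have "\<delta>1 * \<theta>\<^sup>2 \<le> 2 * \<mu>"
      using delta1(2) A2(1) by (simp add: delta1_bound_def pos_less_divide_eq)
    ultimately have 1: "(x t - xstar) \<bullet> (closest_point ?S (x t - \<delta>1 *\<^sub>R G t) - x t) \<le>
        - k1 \<mu> \<theta> \<delta>1 * a\<^sup>2 + \<delta>1 * (\<theta>h * b) * a"
      and 2: "norm (closest_point ?S (x t - \<delta>1 *\<^sub>R G t) - x t) \<le> (2 + \<delta>1 * \<theta>) * a + \<delta>1 * (\<theta>h * b)"
      using projected_step_estimates[of ?S "x t" xstar \<delta>1 ?F \<mu> \<theta> "G t" "\<theta>h * b"]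
        S xS[OF t0] xstar A1_monotone(2) A2 eG delta1(1) by (simp_all add: a_def)
    have 3: "(x t - xstar) \<bullet> xd t \<le> \<delta>2 * (- k1 \<mu> \<theta> \<delta>1 * a\<^sup>2 + \<delta>1 * (\<theta>h * b) * a)"
      unfolding xd_def inner_scaleR_right using 1 delta2(1) by (intro mult_left_mono) auto
    have 4: "norm (xd t) \<le> \<delta>2 * ((2 + \<delta>1 * \<theta>) * a + \<delta>1 * (\<theta>h * b))"
      unfolding xd_def norm_scaleR using 2 delta2(1) by simp
    \<comment> \<open>Here \<open>M\<close> arises: 2 from the symmetric form, \<open>p\<close> from
      \<open>H t\<close>, \<open>l\<close> from the derivative of the tracked signal, and
      \<open>sqrt (\<alpha>\<^sup>2 + 1)\<close> from the input map.\<close>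
    have 5: "2 * (g \<bullet> (H t *v z t)) \<le> M * b * (\<delta>2 * ((2 + \<delta>1 * \<theta>) * a + \<delta>1 * (\<theta>h * b)))"
    proof -
      have "norm (fd t) \<le> l * norm (xd t)"
        unfolding fd_def by (rule order_trans[OF norm_matnorm]) (intro mult_right_mono A3_phi(2) norm_ge_zero)
      then have ng: "norm g \<le> sqrt (\<alpha>\<^sup>2 + 1) * (l * norm (xd t))"
        unfolding g_def by (rule order_trans[OF norm_err_coord_input[OF Q] mult_left_mono]) simp
      have nH: "norm (H t *v z t) \<le> p * b"
        unfolding b_def by (rule order_trans[OF norm_matnorm]) (use p(2) t0 in \<open>auto intro: mult_right_mono\<close>)
      have "g \<bullet> (H t *v z t) \<le> norm g * norm (H t *v z t)" by (rule norm_cauchy_schwarz)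
      also have "\<dots> \<le> (sqrt (\<alpha>\<^sup>2 + 1) * (l * norm (xd t))) * (p * b)"
        by (rule mult_mono[OF ng nH]) (use A3_phi(1) in auto)
      finally have "2 * (g \<bullet> (H t *v z t)) \<le> M * b * norm (xd t)"
        by (simp add: M_def M_const_def mult_ac)
      also have "\<dots> \<le> M * b * (\<delta>2 * ((2 + \<delta>1 * \<theta>) * a + \<delta>1 * (\<theta>h * b)))"
        using 4 M nn by (intro mult_left_mono) auto
      finally show ?thesis .
    qed
    \<comment> \<open>The mixed terms, \<delta>1 \<theta>h from the projected step and M (2 +
      \<delta>1 \<theta>) from the input, add up to 2 k2; the part of x' caused by the gradient
      error gives the contribution k3 to the coefficient of \<open>b\<^sup>2\<close>.\<close>
    have "D \<le> - (\<delta>2 * k1 \<mu> \<theta> \<delta>1 * a\<^sup>2 - 2 * (\<delta>2 * k2 \<theta> \<theta>h M \<delta>1) * a * b + (1 - \<delta>2 * k3 \<theta>h M \<delta>1) * b\<^sup>2)"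
    proof -
      have "- (\<delta>2 * k1 \<mu> \<theta> \<delta>1 * a\<^sup>2 - 2 * (\<delta>2 * k2 \<theta> \<theta>h M \<delta>1) * a * b + (1 - \<delta>2 * k3 \<theta>h M \<delta>1) * b\<^sup>2) =
          \<delta>2 * (- k1 \<mu> \<theta> \<delta>1 * a\<^sup>2 + \<delta>1 * (\<theta>h * b) * a) - b\<^sup>2 +
          M * b * (\<delta>2 * ((2 + \<delta>1 * \<theta>) * a + \<delta>1 * (\<theta>h * b)))"
        by (simp add: k2_def k3_def power2_eq_square algebra_simps add_divide_distrib)
      then show ?thesis
        using 3 5 unfolding D_def b_def[symmetric] by linarith
    qed
    also have "\<dots> \<le> - e * W t"
      using e(2)[of a b] by (simp add: W_def a_def b_def)
    finally show ?thesis using der by blast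
  qed

  \<comment> \<open>The factor \<open>1 / 2 + h2\<close> is an upper bound for V/W, with 1/2 from
    the weight of |x - x*|^2 in V; dividing \<open>e\<close> by it turns decay in terms of
    \<open>W\<close> into a rate for \<open>V\<close>. The lower bound \<open>c1\<close> is the
    smaller of the two weights.\<close>
  define r where "r = e / (1 / 2 + h2)"
  define c1 where "c1 = min (1 / 2) h1"
  have r: "r > 0" using e(1) h(2) by (simp add: r_def add_pos_pos)
  have c1: "c1 > 0" using h(1) by (simp add: c1_def)
  have VW: "c1 * W t \<le> V t" "V t \<le> (1 / 2 + h2) * W t" if "t \<ge> 0" for t
  proof -
    have "c1 * (norm (x t - xstar))\<^sup>2 \<le> 1 / 2 * (norm (x t - xstar))\<^sup>2"
      "c1 * (norm (z t))\<^sup>2 \<le> h1 * (norm (z t))\<^sup>2"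
      by (intro mult_right_mono; simp add: c1_def)+
    then show "c1 * W t \<le> V t"
      using h(3)[OF that, of "z t"] by (simp add: V_def W_def distrib_left)
    have "0 \<le> h2 * (norm (x t - xstar))\<^sup>2" "0 \<le> (norm (z t))\<^sup>2" using h(2) by simp_all
    then show "V t \<le> (1 / 2 + h2) * W t"
      using h(3)[OF that, of "z t"] unfolding V_def W_def distrib_left distrib_right by linarith
  qed
  have cz: "continuous_on {0..} z"
    unfolding z_def
    by (intro bounded_linear.continuous_on[OF bounded_linear_err_coord] continuous_on_Pair cont
        continuous_on_compose2[of UNIV ?f "{0..}" x])
      (auto intro!: has_derivative_continuous_on stack_map_has_derivative smooth_phi)
  have cV: "continuous_on {0..} V"
    unfolding V_def matrix_vector_mult_def by (intro continuous_intros cont cz Hc) simp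
  have Vexp: "V t \<le> V 0 * exp (- r * t)" if "t \<ge> 0" for t
  proof (rule piecewise_gronwall[OF switching cV _ that])
    fix j t assume "t \<in> {ts j..<ts (Suc j)}"
    then have t: "t \<in> I j" by (simp add: I_def)
    have "r * V t \<le> r * ((1 / 2 + h2) * W t)"
      using VW(2)[OF I_nonneg[OF t]] r by (intro mult_left_mono) auto
    also have "\<dots> = e * W t" using h(2) by (simp add: r_def)
    finally show "\<exists>D. (V has_vector_derivative D) (at t within {ts j..<ts (Suc j)}) \<and> D \<le> - r * V t"
      using dV[OF t] unfolding I_def by force
  qed
  \<comment> \<open>Amplitude for the norms themselves: \<open>V 0 / c1\<close> bounds the squares,
    and the square root also halves the rate to \<open>r / 2\<close>.\<close>
  define B where "B = sqrt (V 0 / c1)"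
  have V0: "V 0 \<ge> 0" using VW(1)[of 0] c1 by (auto simp: W_def intro: order_trans[rotated])
  have B0: "B \<ge> 0" by (simp add: B_def V0 c1 less_imp_le)
  have bound: "norm (x t - xstar) \<le> B * exp (- (r / 2) * t)" "norm (z t) \<le> B * exp (- (r / 2) * t)"
    if "t \<ge> 0" for t
  proof -
    have "c1 * W t \<le> V 0 * exp (- r * t)" using VW(1)[OF that] Vexp[OF that] by simp
    then have "W t \<le> V 0 / c1 * exp (- r * t)" using c1 by (simp add: field_simps)
    also have "\<dots> = (B * exp (- (r / 2) * t))\<^sup>2"
      using V0 c1 by (simp add: B_def power_mult_distrib exp_double[symmetric])
    finally have W: "W t \<le> (B * exp (- (r / 2) * t))\<^sup>2" .
    have "(norm (x t - xstar))\<^sup>2 \<le> W t" "(norm (z t))\<^sup>2 \<le> W t" by (simp_all add: W_def)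
    then show "norm (x t - xstar) \<le> B * exp (- (r / 2) * t)" "norm (z t) \<le> B * exp (- (r / 2) * t)"
      using W B0 by (meson order_trans power2_le_imp_le mult_nonneg_nonneg exp_ge_zero)+
  qed

  \<comment> \<open>The 3 counts one direct error for each of the components x, s and v; the other
    two terms pay for moving the signal from x(t) to x* in the limits of s and v. Adding 1 keeps
    \<open>C\<close> positive even if \<open>B = 0\<close>, that is, for a start at the
    limit.\<close>
  define C where "C = B * (3 + l * matnorm ?P + \<alpha> * l * matnorm (mat 1 - ?P)) + 1"
  have mn: "matnorm B \<ge> 0" for B :: "real^('p \<times> 'n)^('p \<times> 'n)"
    unfolding matnorm_def by (rule onorm_pos_le) (simp add: matrix_vector_mul_bounded_linear)
  have "C > 0"
    unfolding C_def using B0 A3_phi(1) gains(1) mn[of ?P] mn[of "mat 1 - ?P"]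
    by (intro add_nonneg_pos mult_nonneg_nonneg add_nonneg_nonneg) auto
  moreover have "norm ((x t, s t, v t) -
      (xstar, ?P *v ?f xstar, \<alpha> *\<^sub>R ((mat 1 - ?P) *v ?f xstar))) \<le> C * exp (- (r / 2) * t)"
    if t: "t \<ge> 0" for t
  proof -
    let ?E = "B * exp (- (r / 2) * t)"
    have lip: "norm (A *v ?f (x t) - A *v ?f xstar) \<le> matnorm A * (l * ?E)"
      for A :: "real^('p \<times> 'n)^('p \<times> 'n)"
    proof -
      have "norm (A *v ?f (x t) - A *v ?f xstar) \<le> matnorm A * norm (?f (x t) - ?f xstar)"
        using norm_matnorm[of A "?f (x t) - ?f xstar"] by (simp add: matrix_vector_mult_diff_distrib)
      also have "norm (?f (x t) - ?f xstar) \<le> l * norm (x t - xstar)"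
        by (rule stack_map_lipschitz[where \<phi> = \<phi>, OF smooth_phi A3_phi(2)])
      also have "\<dots> \<le> l * ?E" using bound(1)[OF t] A3_phi(1) by simp
      finally show ?thesis using mn by (simp add: mult_left_mono)
    qed
    have s: "norm (s t - ?P *v ?f xstar) \<le> ?E + matnorm ?P * (l * ?E)"
    proof -
      have "norm (s t - ?P *v ?f (x t)) \<le> ?E"
        using norm_err_coord_ge(1)[OF Q] bound(2)[OF t] unfolding z_def by (rule order_trans)
      then show ?thesis
        using lip[of ?P] norm_triangle_ineq[of "s t - ?P *v ?f (x t)" "?P *v ?f (x t) - ?P *v ?f xstar"] by simp
    qed
    have v: "norm (v t - \<alpha> *\<^sub>R ((mat 1 - ?P) *v ?f xstar)) \<le> ?E + \<alpha> * (matnorm (mat 1 - ?P) * (l * ?E))"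
    proof -
      let ?R = "mat 1 - ?P"
      have "?f (x t) - ?P *v ?f (x t) = ?R *v ?f (x t)" by (simp add: matrix_vector_mult_diff_rdistrib)
      then have 1: "norm (v t - \<alpha> *\<^sub>R (?R *v ?f (x t))) \<le> ?E"
        using order_trans[OF norm_err_coord_ge(2)[OF Q vsum[OF t]] bound(2)[OF t, unfolded z_def]] by simp
      have "norm (\<alpha> *\<^sub>R (?R *v ?f (x t)) - \<alpha> *\<^sub>R (?R *v ?f xstar)) \<le> \<alpha> * (matnorm ?R * (l * ?E))"
        unfolding scaleR_diff_right[symmetric] norm_scaleR using lip[of ?R] gains(1) by simp
      then show ?thesis
        using 1 norm_triangle_ineq[of "v t - \<alpha> *\<^sub>R (?R *v ?f (x t))"
            "\<alpha> *\<^sub>R (?R *v ?f (x t)) - \<alpha> *\<^sub>R (?R *v ?f xstar)"] by simp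
    qed
    have "norm ((x t, s t, v t) - (xstar, ?P *v ?f xstar, \<alpha> *\<^sub>R ((mat 1 - ?P) *v ?f xstar))) \<le>
        norm (x t - xstar) + (norm (s t - ?P *v ?f xstar) + norm (v t - \<alpha> *\<^sub>R ((mat 1 - ?P) *v ?f xstar)))"
      unfolding diff_Pair by (intro order_trans[OF norm_Pair_le] add_left_mono order_refl norm_Pair_le)
    also have "\<dots> \<le> ?E + ((?E + matnorm ?P * (l * ?E)) + (?E + \<alpha> * (matnorm (mat 1 - ?P) * (l * ?E))))"
      by (intro add_mono bound(1)[OF t] s v)
    also have "\<dots> = (C - 1) * exp (- (r / 2) * t)"
      by (simp add: C_def algebra_simps)
    also have "\<dots> \<le> C * exp (- (r / 2) * t)" by (simp add: mult_right_mono)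
    finally show ?thesis .
  qed
  ultimately show ?thesis
    unfolding converges_exponentially_def using r half_gt_zero by blast
qed

end
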